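(* Let $m\ge 2$ and let $\gamma_0,\gamma_1,\dots,\gamma_m\in\mathbb{Q}$ be distinct rational numbers, $\overline\gamma=(\gamma_0,\dots,\gamma_m)^T$. Put $c_2=13$ and $c_m=12$ for $m\ge3$. Then there is a real number $$\hat B(\overline\gamma)\le c_m m^2\sqrt{\log\bigl(g_1(\overline\gamma)(1+g_3(\overline\gamma))\bigr)}$$ such that for every $\overline\beta=(\beta_0,\dots,\beta_m)^T\in\mathbb{Z}^{m+1}\setminus\{\overline0\}$ with $M=\max_{0\le i\le m}|\beta_i|$ satisfying $$\log M\ \ge\ 96m^2\log\bigl(g_1(\overline\gamma)(1+g_3(\overline\gamma))\bigr)\,e^{192m^2\log(g_1(\overline\gamma)(1+g_3(\overline\gamma)))},$$ one has $$\left|\beta_0e^{\gamma_0}+\beta_1e^{\gamma_1}+\cdots+\beta_me^{\gamma_m}\right|>\frac{M^{1-\hat\delta(M)}}{h_0h_1\cdots h_m}$$ with some $\hat\delta(M)\le\hat B(\overline\gamma)/\sqrt{\log\log M}$, where $h_i=\max\{1,|\beta_i|\}$.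
   Context: Write $\gamma_j=x_j/y_j$ in lowest terms with $x_j\in\mathbb{Z}$, $y_j\in\mathbb{Z}^+$ ($j=0,\dots,m$). Then $g_1(\overline\gamma)=\operatorname{lcm}(y_0,\dots,y_m)$ and $g_3(\overline\gamma)=\max_{0\le j\le m}|\gamma_j|$. *)

theory Defs
  imports Complex_Main
begin

text \<open>
  Vectors with entries indexed by \<open>0, \<dots>, m\<close> are functions on \<^typ>\<open>nat\<close>; only their
  values on \<open>{0..m}\<close> are used.
\<close>

text \<open>
  \<^const>\<open>quotient_of\<close> returns the fraction in lowest terms with positive denominator.
\<close>

definition g1 :: "nat \<Rightarrow> (nat \<Rightarrow> rat) \<Rightarrow> int"
  where "g1 m \<gamma> = Lcm ((\<lambda>j. snd (quotient_of (\<gamma> j))) ` {0..m})"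

definition g3 :: "nat \<Rightarrow> (nat \<Rightarrow> rat) \<Rightarrow> rat"
  where "g3 m \<gamma> = Max ((\<lambda>j. \<bar>\<gamma> j\<bar>) ` {0..m})"

definition log_g :: "nat \<Rightarrow> (nat \<Rightarrow> rat) \<Rightarrow> real"
  where "log_g m \<gamma> = ln (real_of_int (g1 m \<gamma>) * (1 + real_of_rat (g3 m \<gamma>)))"

text \<open>Only used for \<open>m \<ge> 2\<close>.\<close>

definition c_const :: "nat \<Rightarrow> real"
  where "c_const m = (if m = 2 then 13 else 12)"

definition max_abs :: "nat \<Rightarrow> (nat \<Rightarrow> int) \<Rightarrow> int"
  where "max_abs m \<beta> = Max ((\<lambda>i. \<bar>\<beta> i\<bar>) ` {0..m})"

definition h :: "(nat \<Rightarrow> int) \<Rightarrow> nat \<Rightarrow> int"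
  where "h \<beta> i = max 1 \<bar>\<beta> i\<bar>"

end

theory Submission
  imports Defs "Jordan_Normal_Form.Determinant" "HOL-Computational_Algebra.Polynomial_FPS"
    "HOL-Combinatorics.Transposition" "HOL-Library.FuncSet"
begin

text \<open>
  Let \<open>\<beta> i\<^sub>0\<close> be the entry of largest absolute value, moved to index 0, and put
  \<open>\<theta> i = \<gamma> i - \<gamma> i\<^sub>0\<close>. Siegel's lemma gives a nonzero polynomial \<open>Q\<close> of degree at most \<open>N\<close> such that the
  coefficients of \<open>z\<^sup>s\<close> in \<open>Q(z) exp (\<theta> i z)\<close> vanish for \<open>N < s \<le> N + w i\<close>, with only \<open>D\<close> more unknowns
  than equations. Truncating at degree \<open>N\<close> yields polynomials \<open>P i\<close>, and applying \<open>d/dz - \<theta> i\<close>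
  repeatedly yields further simultaneous approximations of the numbers \<open>exp (\<theta> i)\<close> by rationals
  with common denominator, the \<open>i\<close>-th error being of size about \<open>1 / |\<beta> i|\<close> if \<open>w i\<close> is chosen
  accordingly. The determinant of the matrix \<open>(d/dz - \<theta> i)\<^sup>k P i\<close> is a nonzero polynomial of degree at
  most \<open>(m + 1) N\<close> which has a zero of almost that order at 0, so its order at 1 is small.
  Hence some early approximation has a nonzero integer value \<open>\<Sum>i. \<beta> i p i\<close>, and
  \<open>1 \<le> \<bar>\<Sum>i. \<beta> i p i\<bar> \<le> \<bar>p 0\<bar> \<bar>\<Sum>i. \<beta> i exp (\<theta> i)\<bar> + 1/2\<close>. Approximating the numbers
  \<open>exp (\<theta> i)\<close> simultaneously, rather than working with several small linear forms, keeps the total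
  loss of order \<open>m\<^sup>2\<close>.
\<close>

section \<open>Zero estimate\<close>

text \<open>\<open>twist \<theta>\<close> is d/dz conjugated by exp(\<theta> z): it sends p to
  exp(\<theta> z) (exp(-\<theta> z) p)'. Its iterates follow the derivatives of exp(-\<theta> z) p
  without leaving the polynomials.\<close>

definition twist :: "real \<Rightarrow> real poly \<Rightarrow> real poly"
  where "twist \<theta> p = pderiv p - smult \<theta> p"

definition fps_twist :: "real \<Rightarrow> real fps \<Rightarrow> real fps"
  where "fps_twist \<theta> F = fps_deriv F - fps_const \<theta> * F"

lemma fps_of_poly_twist_funpow:
  "fps_of_poly ((twist \<theta> ^^ k) p) = (fps_twist \<theta> ^^ k) (fps_of_poly p)"
  by (induction k) (simp_all add: twist_def fps_twist_def fps_of_poly_diff fps_of_poly_smult fps_of_poly_pderiv)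

lemma fps_deriv_funpow_exp_mult:
  "(fps_deriv ^^ k) (fps_exp (- \<theta>) * F) = fps_exp (- \<theta>) * (fps_twist \<theta> ^^ k) F"
  by (induction k) (simp_all add: fps_twist_def algebra_simps flip: fps_const_neg)

text \<open>Because the twist passes through exp(\<theta> z) as plain differentiation, a twisted
  remainder exp(\<theta> z) Q - P is again of this kind, with Q replaced by its derivative.\<close>

lemma fps_twist_funpow_exp_mult:
  "(fps_twist \<theta> ^^ k) (fps_exp \<theta> * F) = fps_exp \<theta> * (fps_deriv ^^ k) F"
  by (induction k) (simp_all add: fps_twist_def algebra_simps)

lemma fps_twist_funpow_diff:
  "(fps_twist \<theta> ^^ k) (F - G) = (fps_twist \<theta> ^^ k) F - (fps_twist \<theta> ^^ k) G"
proof (induction k)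
  case (Suc k)
  have "fps_twist \<theta> (F - G) = fps_twist \<theta> F - fps_twist \<theta> G" for F G
    by (simp add: fps_twist_def algebra_simps)
  with Suc show ?case by simp
qed simp

lemma fps_deriv_funpow_diff:
  "(fps_deriv ^^ k) (F - G) = (fps_deriv ^^ k) F - (fps_deriv ^^ k) (G :: 'a :: comm_ring_1 fps)"
  by (induction k) simp_all

lemma fps_deriv_funpow_lincomb:
  "(fps_deriv ^^ k) (\<Sum>i\<in>I. fps_const (c i) * F i) = (\<Sum>i\<in>I. fps_const (c i) * (fps_deriv ^^ k) (F i :: 'a :: comm_ring_1 fps))"
  by (induction k) (simp_all add: fps_deriv_sum)

text \<open>Translation commutes with d/dz, so orders at 1 can be studied at 0, where formal power
  series are available.\<close>

lemma twist_funpow_shift: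
  "pcompose ((twist \<theta> ^^ k) p) [:1, 1:] = (twist \<theta> ^^ k) (pcompose p [:1, 1:])"
proof (induction k)
  case (Suc k)
  have "pcompose (twist \<theta> q) [:1, 1:] = twist \<theta> (pcompose q [:1, 1:])" for q
    by (simp add: twist_def pcompose_diff pcompose_smult pderiv_pcompose pderiv_pCons)
  with Suc show ?case by simp
qed simp

lemma fps_X_power_dvd_iff:
  "fps_X ^ n dvd (F :: 'a :: comm_ring_1 fps) \<longleftrightarrow> (\<forall>i<n. fps_nth F i = 0)"
proof
  assume "fps_X ^ n dvd F"
  then obtain G where "F = fps_X ^ n * G" by (elim dvdE)
  then show "\<forall>i<n. fps_nth F i = 0" by (simp add: fps_X_power_mult_nth)
next
  assume *: "\<forall>i<n. fps_nth F i = 0"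
  have "F = fps_X ^ n * fps_shift n F"
    using * by (auto simp: fps_eq_iff fps_X_power_mult_nth)
  then show "fps_X ^ n dvd F" by (rule dvdI)
qed

lemma fps_deriv_funpow_dvd:
  "fps_X ^ n dvd F \<Longrightarrow> fps_X ^ (n - k) dvd (fps_deriv ^^ k) (F :: 'a :: comm_ring_1 fps)"
proof (induction k)
  case (Suc k)
  then have "\<forall>i<n - k. fps_nth ((fps_deriv ^^ k) F) i = 0"
    by (simp add: fps_X_power_dvd_iff)
  then show ?case by (simp add: fps_X_power_dvd_iff)
qed simp

lemma degree_twist_funpow: "degree ((twist \<theta> ^^ k) p) \<le> degree p"
proof (induction k)
  case (Suc k)
  have "degree (twist \<theta> q) \<le> degree q" for q
    unfolding twist_def by (rule degree_diff_le) (simp_all add: degree_pderiv degree_smult_le)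
  with Suc show ?case using order_trans by auto
qed simp

text \<open>Differentiation lowers the degree, so only the factor -\<theta> reaches this
  coefficient. It is taken at \<open>degree p\<close> because for \<open>\<theta> = 0\<close> the
  degree drops as soon as k > 0.\<close>

lemma lead_coeff_twist_funpow:
  "coeff ((twist \<theta> ^^ k) p) (degree p) = (- \<theta>) ^ k * lead_coeff p"
proof (induction k)
  case (Suc k)
  have "coeff ((twist \<theta> ^^ k) p) (Suc (degree p)) = 0"
    using degree_twist_funpow[of k \<theta> p] by (intro coeff_eq_0) auto
  moreover have "coeff (twist \<theta> q) (degree p)
      = of_nat (Suc (degree p)) * coeff q (Suc (degree p)) - \<theta> * coeff q (degree p)" for q
    by (simp add: twist_def coeff_pderiv)
  ultimately show ?case using Suc by simp
qed simp

section \<open>Top coefficients of products, and determinants expanded by columns\<close>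

lemma coeff_mult_degree_bound:
  assumes p: "degree p \<le> a" and q: "degree (q :: 'a :: comm_semiring_0 poly) \<le> b"
  shows "coeff (p * q) (a + b) = coeff p a * coeff q b"
proof -
  have "coeff (p * q) (a + b) = (\<Sum>i\<le>a + b. coeff p i * coeff q (a + b - i))"
    by (rule coeff_mult)
  also have "\<dots> = (\<Sum>i\<in>{a}. coeff p i * coeff q (a + b - i))"
  proof (rule sum.mono_neutral_right)
    show "\<forall>i\<in>{..a + b} - {a}. coeff p i * coeff q (a + b - i) = 0"
    proof
      fix i assume "i \<in> {..a + b} - {a}"
      then have "a < i \<or> b < a + b - i" by auto
      then show "coeff p i * coeff q (a + b - i) = 0"
        using p q by (auto simp: coeff_eq_0)
    qed
  qed auto
  finally show ?thesis by simp
qed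

text \<open>Both claims go through one induction, since the step for the coefficient needs the
  degree bound of the remaining product.\<close>

lemma coeff_prod_degree_bound:
  assumes "finite I" "\<And>i. i \<in> I \<Longrightarrow> degree (f i :: 'a :: comm_semiring_1 poly) \<le> d i"
  shows "coeff (\<Prod>i\<in>I. f i) (\<Sum>i\<in>I. d i) = (\<Prod>i\<in>I. coeff (f i) (d i))
    \<and> degree (\<Prod>i\<in>I. f i) \<le> (\<Sum>i\<in>I. d i)"
  using assms
proof (induction I)
  case (insert x I)
  have "degree (f x * prod f I) \<le> d x + sum d I"
    using insert by (intro order_trans[OF degree_mult_le] add_mono) auto
  moreover have "coeff (f x * prod f I) (d x + sum d I) = coeff (f x) (d x) * coeff (prod f I) (sum d I)"
    by (rule coeff_mult_degree_bound) (use insert in auto)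
  ultimately show ?case using insert by simp
qed simp

text \<open>A kernel vector of the transpose is the coefficient vector of a nonzero polynomial of
  degree below n with the n distinct roots \<open>x i\<close>.\<close>

lemma vandermonde_det_nonzero:
  fixes x :: "nat \<Rightarrow> 'a :: field"
  assumes inj: "inj_on x {..<n}"
  shows "det (mat n n (\<lambda>(k, i). x i ^ k) :: 'a mat) \<noteq> 0"
proof
  let ?V = "mat n n (\<lambda>(k, i). x i ^ k) :: 'a mat"
  assume "det ?V = 0"
  then have "det (transpose_mat ?V) = 0"
    by (simp add: det_transpose[of _ n])
  then obtain v where v: "v \<in> carrier_vec n" "v \<noteq> 0\<^sub>v n" "transpose_mat ?V *\<^sub>v v = 0\<^sub>v n"
    using det_0_iff_vec_prod_zero[of "transpose_mat ?V" n] by auto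
  define p where "p = (\<Sum>k<n. monom (v $ k) k)"
  have coeff_p: "coeff p k = (if k < n then v $ k else 0)" for k
    by (simp add: p_def coeff_sum if_distrib[of "\<lambda>p. coeff p _"] cong: if_cong)
  have "p \<noteq> 0"
  proof
    assume "p = 0"
    then have "v $ k = 0" if "k < n" for k
      using coeff_p[of k] that by simp
    then have "v = 0\<^sub>v n" using v(1) by (intro eq_vecI) auto
    with v(2) show False by simp
  qed
  have "poly p (x i) = 0" if "i < n" for i
  proof -
    have "(transpose_mat ?V *\<^sub>v v) $ i = 0" using v(3) that by simp
    then have "(\<Sum>k = 0..<n. x i ^ k * v $ k) = 0"
      using that v(1) by (simp add: scalar_prod_def)
    then show ?thesis
      by (simp add: p_def poly_sum poly_monom atLeast0LessThan mult.commute)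
  qed
  then have "x ` {..<n} \<subseteq> {y. poly p y = 0}" by auto
  then have "card (x ` {..<n}) \<le> degree p"
    using card_poly_roots_bound[OF \<open>p \<noteq> 0\<close>] card_mono[OF poly_roots_finite[OF \<open>p \<noteq> 0\<close>]]
    by (meson order_trans)
  then have "n \<le> degree p" by (simp add: card_image[OF inj])
  moreover have "coeff p (degree p) \<noteq> 0" using \<open>p \<noteq> 0\<close> by simp
  ultimately show False using coeff_p[of "degree p"] by simp
qed

text \<open>The permutation acts on the row index, so every term has exactly one factor from each
  column. All later estimates of determinants depend on the column only.\<close>

lemma det_columns:
  assumes "(A :: 'a :: comm_ring_1 mat) \<in> carrier_mat n n"
  shows "det A = (\<Sum>p | p permutes {0..<n}. signof p * (\<Prod>i<n. A $$ (p i, i)))"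
proof -
  have "det A = det (transpose_mat A)" using det_transpose[OF assms] by simp
  also have "\<dots> = (\<Sum>p | p permutes {0..<n}. signof p * (\<Prod>i = 0..<n. transpose_mat A $$ (i, p i)))"
    by (rule det_def') (use assms in auto)
  also have "\<dots> = (\<Sum>p | p permutes {0..<n}. signof p * (\<Prod>i<n. A $$ (p i, i)))"
  proof (intro sum.cong arg_cong2[where f = "(*)"] refl)
    fix p assume "p \<in> {p. p permutes {0..<n}}"
    then have "p i < n" if "i < n" for i
      using permutes_in_image[of p "{0..<n}" i] that by auto
    then show "(\<Prod>i = 0..<n. transpose_mat A $$ (i, p i)) = (\<Prod>i<n. A $$ (p i, i))"
      using assms by (intro prod.cong) auto
  qed
  finally show ?thesis .
qed

section \<open>The determinant of twisted derivatives: degree, non-vanishing, and orders at 0 and at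
  1\<close>

definition twist_mat :: "nat \<Rightarrow> (nat \<Rightarrow> real) \<Rightarrow> (nat \<Rightarrow> real poly) \<Rightarrow> real poly mat"
  where "twist_mat n \<theta> P = mat n n (\<lambda>(k, i). (twist (\<theta> i) ^^ k) (P i))"

definition wronski_mat :: "nat \<Rightarrow> (nat \<Rightarrow> real fps) \<Rightarrow> real fps mat"
  where "wronski_mat n f = mat n n (\<lambda>(k, i). (fps_deriv ^^ k) (f i))"

lemma twist_mat_carrier [simp]: "twist_mat n \<theta> P \<in> carrier_mat n n"
  by (simp add: twist_mat_def)

lemma wronski_mat_carrier [simp]: "wronski_mat n f \<in> carrier_mat n n"
  by (simp add: wronski_mat_def)

lemma permutes_lessThan: "p permutes {0..<n} \<Longrightarrow> i < n \<Longrightarrow> p i < (n :: nat)"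
  using permutes_in_image[of p "{0..<n}" i] by auto

lemma prod_dvd_det:
  assumes A: "(A :: 'a :: comm_ring_1 mat) \<in> carrier_mat n n"
    and dvd: "\<And>k i. k < n \<Longrightarrow> i < n \<Longrightarrow> d i dvd A $$ (k, i)"
  shows "(\<Prod>i<n. d i) dvd det A"
  unfolding det_columns[OF A]
  by (intro dvd_sum dvd_mult prod_dvd_prod) (use permutes_lessThan dvd in auto)

lemma coeff_signof_mult: "coeff (signof p * (f :: real poly)) k = signof p * coeff f k"
  by (simp add: sign_def)

lemma degree_det_twist_mat:
  assumes "\<And>i. i < n \<Longrightarrow> degree (P i) \<le> N"
  shows "degree (det (twist_mat n \<theta> P)) \<le> n * N"
  unfolding det_columns[OF twist_mat_carrier]
proof (rule degree_sum_le)
  fix p assume "p \<in> {p. p permutes {0..<n}}"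
  then have p: "p i < n" if "i < n" for i using permutes_lessThan that by auto
  have "degree (\<Prod>i<n. twist_mat n \<theta> P $$ (p i, i)) \<le> (\<Sum>i<n. N)"
    by (rule conjunct2[OF coeff_prod_degree_bound])
       (use p assms in \<open>auto simp: twist_mat_def intro!: order_trans[OF degree_twist_funpow]\<close>)
  then show "degree (signof p * (\<Prod>i<n. twist_mat n \<theta> P $$ (p i, i))) \<le> n * N"
    by (simp add: sign_def)
qed (simp add: finite_permutations)

text \<open>In the coefficient at the sum of the degrees, column i contributes its leading
  coefficient times a power of \<open>- \<theta> i\<close>; what remains is a Vandermonde
  determinant with distinct nodes.\<close>

lemma det_twist_mat_nonzero:
  assumes inj: "inj_on \<theta> {..<n}" and P: "\<And>i. i < n \<Longrightarrow> P i \<noteq> 0"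
  shows "det (twist_mat n \<theta> P) \<noteq> 0"
proof -
  let ?V = "mat n n (\<lambda>(k, i). (- \<theta> i) ^ k) :: real mat"
  let ?d = "\<Sum>i<n. degree (P i)"
  have "coeff (det (twist_mat n \<theta> P)) ?d
      = (\<Sum>p | p permutes {0..<n}. signof p * coeff (\<Prod>i<n. twist_mat n \<theta> P $$ (p i, i)) ?d)"
    by (simp add: det_columns[OF twist_mat_carrier] coeff_sum coeff_signof_mult)
  also have "\<dots> = (\<Sum>p | p permutes {0..<n}. (\<Prod>i<n. lead_coeff (P i)) * (signof p * (\<Prod>i<n. ?V $$ (p i, i))))"
  proof (rule sum.cong[OF refl])
    fix p assume "p \<in> {p. p permutes {0..<n}}"
    then have p: "p i < n" if "i < n" for i using permutes_lessThan that by auto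
    have "coeff (\<Prod>i<n. twist_mat n \<theta> P $$ (p i, i)) ?d
        = (\<Prod>i<n. coeff (twist_mat n \<theta> P $$ (p i, i)) (degree (P i)))"
      by (rule conjunct1[OF coeff_prod_degree_bound])
         (use p degree_twist_funpow in \<open>auto simp: twist_mat_def\<close>)
    also have "\<dots> = (\<Prod>i<n. ?V $$ (p i, i) * lead_coeff (P i))"
      by (rule prod.cong) (use p in \<open>auto simp: twist_mat_def lead_coeff_twist_funpow\<close>)
    finally show "signof p * coeff (\<Prod>i<n. twist_mat n \<theta> P $$ (p i, i)) ?d
        = (\<Prod>i<n. lead_coeff (P i)) * (signof p * (\<Prod>i<n. ?V $$ (p i, i)))"
      by (simp add: prod.distrib)
  qed
  also have "\<dots> = (\<Prod>i<n. lead_coeff (P i)) * det ?V"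
    by (simp add: sum_distrib_left det_columns[of ?V n])
  also have "\<dots> \<noteq> 0"
    using vandermonde_det_nonzero[of "\<lambda>i. - \<theta> i" n] inj P by (auto simp: inj_on_def)
  finally show ?thesis by auto
qed

lemma fps_of_poly_signof: "fps_of_poly (signof p * f) = signof p * (fps_of_poly f :: real fps)"
  by (simp add: sign_def fps_of_poly_uminus)

text \<open>Column i of the Wronskian is exp(-\<theta> i z) times column i of the twisted
  matrix.\<close>

lemma det_wronski_mat_exp:
  "det (wronski_mat n (\<lambda>i. fps_exp (- \<theta> i) * fps_of_poly (P i)))
    = (\<Prod>i<n. fps_exp (- \<theta> i)) * fps_of_poly (det (twist_mat n \<theta> P))" (is "det ?W = _")
proof -
  have "det ?W = (\<Sum>p | p permutes {0..<n}. signof p * (\<Prod>i<n. ?W $$ (p i, i)))"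
    by (rule det_columns) simp
  also have "\<dots> = (\<Sum>p | p permutes {0..<n}. (\<Prod>i<n. fps_exp (- \<theta> i)) *
      fps_of_poly (signof p * (\<Prod>i<n. twist_mat n \<theta> P $$ (p i, i))))"
  proof (rule sum.cong[OF refl])
    fix p assume "p \<in> {p. p permutes {0..<n}}"
    then have p: "p i < n" if "i < n" for i using permutes_lessThan that by auto
    have "(\<Prod>i<n. ?W $$ (p i, i)) = (\<Prod>i<n. fps_exp (- \<theta> i) * fps_of_poly (twist_mat n \<theta> P $$ (p i, i)))"
      by (rule prod.cong)
         (use p in \<open>auto simp: wronski_mat_def twist_mat_def fps_deriv_funpow_exp_mult fps_of_poly_twist_funpow\<close>)
    then show "signof p * (\<Prod>i<n. ?W $$ (p i, i)) = (\<Prod>i<n. fps_exp (- \<theta> i)) *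
        fps_of_poly (signof p * (\<Prod>i<n. twist_mat n \<theta> P $$ (p i, i)))"
      by (simp add: prod.distrib fps_of_poly_signof fps_of_poly_prod mult.left_commute)
  qed
  also have "\<dots> = (\<Prod>i<n. fps_exp (- \<theta> i)) * fps_of_poly (det (twist_mat n \<theta> P))"
    by (simp add: det_columns[OF twist_mat_carrier] fps_of_poly_sum sum_distrib_left)
  finally show ?thesis .
qed

text \<open>The product of exponentials is a unit among power series, so both determinants have the
  same order at 0.\<close>

lemma monom_dvd_det_twist_mat:
  assumes "fps_X ^ a dvd det (wronski_mat n (\<lambda>i. fps_exp (- \<theta> i) * fps_of_poly (P i)))"
  shows "monom 1 a dvd det (twist_mat n \<theta> P)"
proof -
  have "fps_nth (\<Prod>i<n. fps_exp (- \<theta> i) :: real fps) 0 = 1"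
    by (induction n) simp_all
  then have "is_unit (\<Prod>i<n. fps_exp (- \<theta> i) :: real fps)"
    by simp
  then have "fps_X ^ a dvd fps_of_poly (det (twist_mat n \<theta> P))"
    using assms unfolding det_wronski_mat_exp by (simp add: dvd_mult_unit_iff')
  then show ?thesis
    by (simp add: monom_1_dvd_iff' fps_X_power_dvd_iff)
qed

text \<open>Subtracting column 0 of the Wronskian from the others turns column i into the
  derivatives of a series of order at least \<open>e i\<close>. At most m differentiations occur,
  hence the loss of m in each column.\<close>

lemma root_order_0_det_twist_mat:
  assumes e: "\<And>i. 0 < i \<Longrightarrow> i \<le> m \<Longrightarrow>
      fps_X ^ e i dvd fps_of_poly (P 0) - fps_exp (- \<theta> i) * fps_of_poly (P i)"
    and e0: "fps_X ^ e 0 dvd fps_of_poly (P 0)" and \<theta>0: "\<theta> 0 = 0"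
  shows "monom 1 (\<Sum>i\<le>m. e i - m) dvd det (twist_mat (Suc m) \<theta> P)"
proof (rule monom_dvd_det_twist_mat)
  define f where "f = (\<lambda>i. fps_exp (- \<theta> i) * fps_of_poly (P i))"
  define f' where "f' = (\<lambda>i. if i = 0 then f 0 else f i - f 0)"
  \<comment> \<open>Right multiplication by \<open>?C\<close> undoes the column subtraction. Its
    determinant can stay unevaluated, since only divisibility of the product is claimed.\<close>
  let ?C = "mat (Suc m) (Suc m) (\<lambda>(j, i). if i = j \<or> j = 0 then 1 else 0) :: real fps mat"
  have f0: "f 0 = fps_of_poly (P 0)" by (simp add: f_def \<theta>0)
  have split: "(\<Sum>j<Suc m. g j * (if i = j \<or> j = 0 then 1 else 0)) = (if i = 0 then g 0 else g i + g 0)"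
    if "i < Suc m" for i and g :: "nat \<Rightarrow> real fps"
  proof -
    have "(\<Sum>j<Suc m. g j * (if i = j \<or> j = 0 then 1 else 0))
        = (\<Sum>j<Suc m. (if j = i then g i else 0) + (if j = 0 then if i = 0 then 0 else g 0 else 0))"
      by (rule sum.cong) auto
    also have "\<dots> = (if i = 0 then g 0 else g i + g 0)"
      using that by (simp only: sum.distrib) (simp add: sum.delta)
    finally show ?thesis .
  qed
  have "wronski_mat (Suc m) f = wronski_mat (Suc m) f' * ?C"
  proof (rule eq_matI)
    fix k i assume "k < dim_row (wronski_mat (Suc m) f' * ?C)" "i < dim_col (wronski_mat (Suc m) f' * ?C)"
    then have ki: "k < Suc m" "i < Suc m" by (simp_all add: wronski_mat_def)
    have "(wronski_mat (Suc m) f' * ?C) $$ (k, i)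
        = (\<Sum>j<Suc m. (fps_deriv ^^ k) (f' j) * (if i = j \<or> j = 0 then 1 else 0))"
      using ki by (simp add: wronski_mat_def scalar_prod_def atLeast0LessThan del: sum.lessThan_Suc)
    also have "\<dots> = (fps_deriv ^^ k) (f i)"
      using split[OF ki(2), of "\<lambda>j. (fps_deriv ^^ k) (f' j)"]
      by (simp add: f'_def fps_deriv_funpow_diff)
    finally show "wronski_mat (Suc m) f $$ (k, i) = (wronski_mat (Suc m) f' * ?C) $$ (k, i)"
      using ki by (simp add: wronski_mat_def)
  qed (simp_all add: wronski_mat_def)
  then have "det (wronski_mat (Suc m) f) = det (wronski_mat (Suc m) f') * det ?C"
    by (simp add: det_mult[of _ "Suc m"])
  moreover have "(\<Prod>i<Suc m. fps_X ^ (e i - m)) dvd det (wronski_mat (Suc m) f')"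
  proof (rule prod_dvd_det)
    fix k i assume ki: "k < Suc m" "i < Suc m"
    have "fps_X ^ e i dvd f' i"
    proof (cases "i = 0")
      case False
      then have "fps_X ^ e i dvd - (f 0 - f i)"
        using e[of i] ki f0 unfolding f_def by (simp only: dvd_minus_iff)
      then show ?thesis using False by (simp add: f'_def)
    qed (use e0 f0 in \<open>simp add: f'_def\<close>)
    then have "fps_X ^ (e i - k) dvd (fps_deriv ^^ k) (f' i)"
      by (rule fps_deriv_funpow_dvd)
    moreover have "fps_X ^ (e i - m) dvd (fps_X ^ (e i - k) :: real fps)"
      using ki by (intro le_imp_power_dvd) auto
    ultimately show "fps_X ^ (e i - m) dvd wronski_mat (Suc m) f' $$ (k, i)"
      using ki dvd_trans by (auto simp: wronski_mat_def)
  qed simp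
  ultimately show "fps_X ^ (\<Sum>i\<le>m. e i - m) dvd
      det (wronski_mat (Suc m) (\<lambda>i. fps_exp (- \<theta> i) * fps_of_poly (P i)))"
    by (simp add: f_def lessThan_Suc_atMost flip: power_sum del: sum.atMost_Suc prod.lessThan_Suc)
qed

lemma pcompose_signof: "pcompose (signof p * f) q = signof p * pcompose f (q :: real poly)"
  by (simp add: sign_def pcompose_uminus)

lemma det_twist_mat_shift:
  "det (twist_mat n \<theta> (\<lambda>i. pcompose (P i) [:1, 1:])) = pcompose (det (twist_mat n \<theta> P)) [:1, 1:]"
  unfolding det_columns[OF twist_mat_carrier] pcompose_sum pcompose_signof pcompose_prod
  by (intro sum.cong prod.cong arg_cong2[where f = "(*)"] refl)
     (auto simp: twist_mat_def permutes_lessThan twist_funpow_shift)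

text \<open>The relations say that the combination \<psi> of the columns, shifted to 0, vanishes to
  order K + 1. Putting \<psi> and its derivatives into column j multiplies the determinant by the
  nonzero constant \<open>\<beta> j\<close> and makes that column highly divisible.\<close>

lemma root_order_1_det_twist_mat:
  assumes j: "j \<le> m" "\<beta> j \<noteq> 0"
    and rel: "\<And>k. k \<le> K \<Longrightarrow> (\<Sum>i\<le>m. \<beta> i * poly ((twist (\<theta> i) ^^ k) (P i)) 1) = 0"
  shows "[:- 1, 1:] ^ (Suc K - m) dvd det (twist_mat (Suc m) \<theta> P)"
proof -
  let ?b = "Suc K - m"
  define p where "p = (\<lambda>i. pcompose (P i) [:1, 1:])"
  \<comment> \<open>The shift would turn exp(-\<theta> i z) into exp(-\<theta> i) exp(-\<theta> i
    z). The constant is dropped, so that the exponential is 1 at the base point and the derivatives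
    of \<psi> at 0 are exactly the sums in \<open>rel\<close>.\<close>
  define f where "f = (\<lambda>i. fps_exp (- \<theta> i) * fps_of_poly (p i))"
  define \<psi> where "\<psi> = (\<Sum>i\<le>m. fps_const (\<beta> i) * f i)"
  let ?W = "wronski_mat (Suc m) f"
  let ?v = "vec (Suc m) (\<lambda>i. fps_const (\<beta> i)) :: real fps vec"
  have \<psi>_deriv: "(fps_deriv ^^ k) \<psi> = (\<Sum>i\<le>m. fps_const (\<beta> i) * (fps_deriv ^^ k) (f i))" for k
    unfolding \<psi>_def by (rule fps_deriv_funpow_lincomb)
  have "fps_nth ((fps_deriv ^^ k) \<psi>) 0 = (\<Sum>i\<le>m. \<beta> i * poly ((twist (\<theta> i) ^^ k) (P i)) 1)" for k
    unfolding \<psi>_deriv f_def p_def fps_deriv_funpow_exp_mult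
    by (simp add: fps_sum_nth poly_pcompose flip: fps_of_poly_twist_funpow twist_funpow_shift poly_0_coeff_0)
  then have nth0: "fps_nth ((fps_deriv ^^ k) \<psi>) 0 = 0" if "k \<le> K" for k
    using rel that by simp
  have "fps_nth ((fps_deriv ^^ k) F) 0 = fact k * fps_nth F k" for k and F :: "real fps"
  proof (induction k arbitrary: F)
    case (Suc k)
    show ?case using Suc[of "fps_deriv F"] by (simp add: funpow_Suc_right algebra_simps del: funpow.simps)
  qed simp
  with nth0 have "fps_nth \<psi> k = 0" if "k \<le> K" for k
    using that by simp
  then have ord: "fps_X ^ Suc K dvd \<psi>"
    unfolding fps_X_power_dvd_iff by (simp add: less_Suc_eq_le)
  have Wv: "?W *\<^sub>v ?v = vec (Suc m) (\<lambda>k. (fps_deriv ^^ k) \<psi>)"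
    by (rule eq_vecI)
       (auto simp: wronski_mat_def scalar_prod_def \<psi>_deriv atLeast0LessThan lessThan_Suc_atMost mult.commute
             simp del: sum.atMost_Suc)
  have "(\<Prod>i<Suc m. if i = j then fps_X ^ ?b else 1) dvd det (replace_col ?W (?W *\<^sub>v ?v) j)"
  proof (rule prod_dvd_det)
    fix k i assume ki: "k < Suc m" "i < Suc m"
    have "fps_X ^ (Suc K - k) dvd (fps_deriv ^^ k) \<psi>"
      by (rule fps_deriv_funpow_dvd[OF ord])
    moreover have "fps_X ^ ?b dvd (fps_X ^ (Suc K - k) :: real fps)"
      using ki by (intro le_imp_power_dvd) auto
    ultimately have "fps_X ^ ?b dvd (fps_deriv ^^ k) \<psi>"
      using dvd_trans by blast
    then show "(if i = j then fps_X ^ ?b else 1) dvd replace_col ?W (?W *\<^sub>v ?v) j $$ (k, i)"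
      unfolding Wv using ki by (simp add: replace_col_def wronski_mat_def)
  qed (simp add: replace_col_def wronski_mat_def)
  \<comment> \<open>This is Cramer's rule: replacing column j by \<open>?W *\<^sub>v ?v\<close>
    scales the determinant by entry j of \<open>?v\<close>.\<close>
  also have "det (replace_col ?W (?W *\<^sub>v ?v) j) = fps_const (\<beta> j) * det ?W"
    using j by (subst cramer_lemma_mat[of _ "Suc m"]) auto
  finally have "fps_X ^ ?b dvd fps_const (\<beta> j) * det ?W"
    using j(1) by (simp add: prod.delta lessThan_Suc_atMost del: prod.lessThan_Suc prod.atMost_Suc)
  then have "fps_X ^ ?b dvd det ?W"
    using j(2) by (simp add: dvd_mult_unit_iff')
  then have "monom 1 ?b dvd det (twist_mat (Suc m) \<theta> p)"
    unfolding f_def by (rule monom_dvd_det_twist_mat)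
  then have "monom 1 ?b dvd pcompose (det (twist_mat (Suc m) \<theta> P)) [:1, 1:]"
    unfolding p_def det_twist_mat_shift .
  then obtain q where q: "pcompose (det (twist_mat (Suc m) \<theta> P)) [:1, 1:] = monom 1 ?b * q"
    by (elim dvdE)
  \<comment> \<open>Substituting z - 1 undoes the shift and carries the power of z to a power of z -
    1.\<close>
  have X_power: "pcompose ([:0, 1:] ^ n) r = r ^ n" for n and r :: "real poly"
    by (induction n) (simp_all add: pcompose_mult pcompose_pCons pcompose_1)
  have "det (twist_mat (Suc m) \<theta> P) = pcompose (pcompose (det (twist_mat (Suc m) \<theta> P)) [:1, 1:]) [:- 1, 1:]"
    by (simp add: pcompose_assoc [symmetric] pcompose_pCons)
  also have "\<dots> = [:- 1, 1:] ^ ?b * pcompose q [:- 1, 1:]"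
    by (simp add: q pcompose_mult monom_altdef X_power)
  finally show ?thesis by simp
qed

text \<open>The determinant is a nonzero polynomial of degree at most (m + 1) N, so its orders at 0
  and at 1 together cannot exceed that degree.\<close>

lemma zero_estimate:
  fixes P :: "nat \<Rightarrow> real poly"
  assumes inj: "inj_on \<theta> {..m}" and \<theta>0: "\<theta> 0 = 0"
    and P: "\<And>i. i \<le> m \<Longrightarrow> P i \<noteq> 0" "\<And>i. i \<le> m \<Longrightarrow> degree (P i) \<le> N"
    and e0: "fps_X ^ e 0 dvd fps_of_poly (P 0)"
    and e: "\<And>i. 0 < i \<Longrightarrow> i \<le> m \<Longrightarrow>
      fps_X ^ e i dvd fps_of_poly (P 0) - fps_exp (- \<theta> i) * fps_of_poly (P i)"
    and \<beta>: "j \<le> m" "\<beta> j \<noteq> 0"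
    and rel: "\<And>k. k \<le> K \<Longrightarrow> (\<Sum>i\<le>m. \<beta> i * poly ((twist (\<theta> i) ^^ k) (P i)) 1) = 0"
  shows "(\<Sum>i\<le>m. e i - m) + (Suc K - m) \<le> Suc m * N"
proof -
  let ?\<Delta> = "det (twist_mat (Suc m) \<theta> P)"
  have nz: "?\<Delta> \<noteq> 0"
    by (rule det_twist_mat_nonzero) (use inj P in \<open>simp_all add: lessThan_Suc_atMost\<close>)
  let ?a = "\<Sum>i\<le>m. e i - m" and ?b = "Suc K - m"
  have "[:0, 1:] ^ ?a dvd ?\<Delta>"
    using root_order_0_det_twist_mat[where e = e and P = P and \<theta> = \<theta> and m = m, OF e e0 \<theta>0]
    by (simp add: monom_altdef del: sum.atMost_Suc)
  then obtain r where r: "?\<Delta> = [:0, 1:] ^ ?a * r" by (elim dvdE)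
  with nz have r0: "r \<noteq> 0" by auto
  have "?b \<le> order 1 ?\<Delta>"
    using root_order_1_det_twist_mat[OF \<beta> rel] nz by (simp add: order_divides)
  also have "order 1 ?\<Delta> = order 1 r"
    unfolding r using r0 by (simp add: order_mult order_0I)
  also have "order 1 r \<le> degree r" by (rule order_degree[OF r0])
  finally have "?a + ?b \<le> degree ?\<Delta>"
    unfolding r using r0 by (simp add: degree_mult_eq degree_power_eq)
  also have "degree ?\<Delta> \<le> Suc m * N"
    by (rule degree_det_twist_mat) (use P in auto)
  finally show ?thesis .
qed

section \<open>Siegel's lemma\<close>

text \<open>Pigeonhole: the (H + 1)^U vectors with entries in 0..H have fewer possible images,
  because each form takes at most A H + 1 <= A (H + 1) values. The difference of two vectors with
  equal image is the solution.\<close>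

lemma siegel_lemma:
  fixes a :: "'j \<Rightarrow> nat \<Rightarrow> int" and A :: real
  assumes J: "finite J" and A: "\<And>j. j \<in> J \<Longrightarrow> real_of_int (\<Sum>k<U. \<bar>a j k\<bar>) \<le> A" "1 \<le> A"
    and le: "card J \<le> U" and less: "A ^ card J < (real H + 1) ^ (U - card J)"
  shows "\<exists>q :: nat \<Rightarrow> int. (\<exists>k<U. q k \<noteq> 0) \<and> (\<forall>k<U. \<bar>q k\<bar> \<le> int H) \<and>
    (\<forall>j\<in>J. (\<Sum>k<U. a j k * q k) = 0)"
proof -
  \<comment> \<open>Positive and negative coefficients are separated so that the range of a form has
    length A H, not 2 A H.\<close>
  define pos where "pos = (\<lambda>j. \<Sum>k<U. max 0 (a j k))"
  define neg where "neg = (\<lambda>j. \<Sum>k<U. max 0 (- a j k))"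
  let ?F = "{..<U} \<rightarrow>\<^sub>E {0..int H}"
  let ?V = "Pi\<^sub>E J (\<lambda>j. {- (neg j * int H)..pos j * int H})"
  let ?f = "\<lambda>q. \<lambda>j\<in>J. \<Sum>k<U. a j k * q k"
  have pn: "pos j + neg j = (\<Sum>k<U. \<bar>a j k\<bar>)" "0 \<le> pos j" "0 \<le> neg j" for j
    by (auto simp: pos_def neg_def simp flip: sum.distrib intro!: sum.cong sum_nonneg)
  have maps: "?f ` ?F \<subseteq> ?V"
  proof (rule image_subsetI, rule PiE_I)
    fix q j assume q: "q \<in> ?F" and j: "j \<in> J"
    have qk: "0 \<le> q k" "q k \<le> int H" if "k < U" for k using q that by (auto simp: PiE_iff)
    have "a j k * q k \<le> max 0 (a j k) * int H" if "k < U" for k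
    proof -
      have "a j k * q k \<le> max 0 (a j k) * q k" using qk[OF that] by (intro mult_right_mono) auto
      also have "\<dots> \<le> max 0 (a j k) * int H" using qk[OF that] by (intro mult_left_mono) auto
      finally show ?thesis .
    qed
    then have "(\<Sum>k<U. a j k * q k) \<le> pos j * int H"
      unfolding pos_def sum_distrib_right by (intro sum_mono) auto
    moreover have "- (a j k * q k) \<le> max 0 (- a j k) * int H" if "k < U" for k
    proof -
      have "- a j k * q k \<le> max 0 (- a j k) * q k" using qk[OF that] by (intro mult_right_mono) auto
      also have "\<dots> \<le> max 0 (- a j k) * int H" using qk[OF that] by (intro mult_left_mono) auto
      finally show ?thesis by simp
    qed
    then have "- (\<Sum>k<U. a j k * q k) \<le> neg j * int H"
      unfolding neg_def sum_distrib_right sum_negf[symmetric] by (intro sum_mono) auto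
    ultimately show "?f q j \<in> {- (neg j * int H)..pos j * int H}"
      using j by simp
  qed simp
  have "real (card ?V) = (\<Prod>j\<in>J. real (card {- (neg j * int H)..pos j * int H}))"
    using J by (simp add: card_PiE)
  also have "\<dots> \<le> (\<Prod>j\<in>J. A * (real H + 1))"
  proof (rule prod_mono)
    fix j assume j: "j \<in> J"
    have "real (card {- (neg j * int H)..pos j * int H}) = real_of_int ((pos j + neg j) * int H + 1)"
      using pn(2,3)[of j] by (simp add: algebra_simps)
    also have "\<dots> = real_of_int (\<Sum>k<U. \<bar>a j k\<bar>) * real H + 1"
      by (simp add: pn)
    also have "\<dots> \<le> A * real H + A"
      using A(1)[OF j] A(2) by (intro add_mono mult_right_mono) auto
    finally show "0 \<le> real (card {- (neg j * int H)..pos j * int H}) \<and>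
        real (card {- (neg j * int H)..pos j * int H}) \<le> A * (real H + 1)"
      by (simp add: algebra_simps)
  qed
  also have "\<dots> = A ^ card J * (real H + 1) ^ card J"
    by (simp add: power_mult_distrib)
  also have "\<dots> < (real H + 1) ^ (U - card J) * (real H + 1) ^ card J"
    using less by (intro mult_strict_right_mono) auto
  also have "\<dots> = real (card ?F)"
    using le by (simp add: card_PiE flip: power_add)
  finally have "card ?V < card ?F" by simp
  have "\<not> inj_on ?f ?F"
  proof
    assume "inj_on ?f ?F"
    then have "card ?F \<le> card ?V"
      using maps J by (intro card_inj_on_le[of ?f]) (auto intro: finite_PiE)
    with \<open>card ?V < card ?F\<close> show False by simp
  qed
  then obtain p p' where pp: "p \<in> ?F" "p' \<in> ?F" "p \<noteq> p'" "?f p = ?f p'"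
    by (auto simp: inj_on_def)
  define q where "q = (\<lambda>k. p k - p' k)"
  from pp(1-3) have "\<exists>k<U. q k \<noteq> 0"
    unfolding q_def by (metis PiE_ext eq_iff_diff_eq_0 lessThan_iff)
  moreover have "\<bar>q k\<bar> \<le> int H" if "k < U" for k
  proof -
    have "0 \<le> p k" "p k \<le> int H" "0 \<le> p' k" "p' k \<le> int H"
      using pp(1,2) that by (auto simp: PiE_iff)
    then show ?thesis by (simp add: q_def)
  qed
  moreover have "(\<Sum>k<U. a j k * q k) = 0" if "j \<in> J" for j
    using fun_cong[OF pp(4), of j] that by (simp add: q_def algebra_simps sum_subtractf)
  ultimately show ?thesis by blast
qed

section \<open>Simultaneous approximation of exponentials\<close>

text \<open>As a function of a, the quotient N^a / a! increases up to a = N and decreases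
  afterwards, so it is largest at a = N.\<close>

lemma fact_mult_power_le: "fact N * real N ^ a \<le> fact a * real N ^ N"
proof (cases "a \<le> N")
  case True
  have "fact (a + d) \<le> fact a * real N ^ d" if "a + d \<le> N" for d
    using that
  proof (induction d)
    case (Suc d)
    then have "real (a + Suc d) * fact (a + d) \<le> real N * (fact a * real N ^ d)"
      by (intro mult_mono) auto
    then show ?case by (simp add: mult_ac)
  qed simp
  from this[of "N - a"] have "fact N \<le> fact a * real N ^ (N - a)" using True by simp
  from mult_right_mono[OF this, of "real N ^ a"] show ?thesis
    using True by (simp add: mult.assoc flip: power_add)
next
  case False
  have "fact N * real N ^ d \<le> fact (N + d)" for d
  proof (induction d)
    case (Suc d)
    then have "real N * (fact N * real N ^ d) \<le> real (N + Suc d) * fact (N + d)"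
      by (intro mult_mono) auto
    then show ?case by (simp add: mult_ac)
  qed simp
  from this[of "a - N"] have "fact N * real N ^ (a - N) \<le> fact a" using False by simp
  from mult_right_mono[OF this, of "real N ^ N"] show ?thesis
    using False by (simp add: mult.assoc flip: power_add)
qed

section \<open>Growth and denominators of the coefficients s! F_s under twisting\<close>

lemma fact_nth_fps_twist:
  "fact s * fps_nth (fps_twist \<theta> F) s = fact (Suc s) * fps_nth F (Suc s) - \<theta> * (fact s * fps_nth F s)"
  by (simp add: fps_twist_def algebra_simps)

text \<open>On the sequence b_s = s! F_s the twist acts as b_(s+1) - \<theta> b_s, without any
  factor growing with s. Each application therefore costs only c + |\<theta>|.\<close>

lemma fps_twist_funpow_bound:
  assumes F: "\<And>s. \<bar>fact s * fps_nth F s\<bar> \<le> C * c ^ s" and "0 \<le> c" "0 \<le> C"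
  shows "\<bar>fact s * fps_nth ((fps_twist \<theta> ^^ k) F) s\<bar> \<le> C * c ^ s * (c + \<bar>\<theta>\<bar>) ^ k"
proof (induction k arbitrary: s)
  case (Suc k)
  let ?G = "(fps_twist \<theta> ^^ k) F"
  have "\<bar>fact s * fps_nth ((fps_twist \<theta> ^^ Suc k) F) s\<bar>
      \<le> \<bar>fact (Suc s) * fps_nth ?G (Suc s)\<bar> + \<bar>\<theta>\<bar> * \<bar>fact s * fps_nth ?G s\<bar>"
    unfolding funpow.simps comp_def fact_nth_fps_twist by (metis abs_mult abs_triangle_ineq4)
  also have "\<dots> \<le> C * c ^ Suc s * (c + \<bar>\<theta>\<bar>) ^ k + \<bar>\<theta>\<bar> * (C * c ^ s * (c + \<bar>\<theta>\<bar>) ^ k)"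
    by (intro add_mono mult_left_mono Suc) simp
  finally show ?case by (simp add: algebra_simps)
qed (use F in simp)

lemma fps_twist_funpow_dvd:
  "fps_X ^ n dvd F \<Longrightarrow> fps_X ^ (n - k) dvd (fps_twist \<theta> ^^ k) F"
proof (induction k)
  case (Suc k)
  then have "\<forall>i<n - k. fps_nth ((fps_twist \<theta> ^^ k) F) i = 0"
    by (simp add: fps_X_power_dvd_iff)
  moreover have "fps_nth (fps_twist \<theta> G) i = of_nat (Suc i) * fps_nth G (Suc i) - \<theta> * fps_nth G i" for G i
    by (simp add: fps_twist_def)
  ultimately show ?case by (simp add: fps_X_power_dvd_iff)
qed simp

text \<open>In the recursion b_(s+1) - \<theta> b_s one further factor g suffices for either term:
  it matches the raised index in the first and clears the denominator of \<theta> in the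
  second.\<close>

lemma fps_twist_funpow_integral:
  assumes g\<theta>: "real_of_int g * \<theta> \<in> \<int>" and F: "\<And>s. real_of_int g ^ s * (fact s * fps_nth F s) / fact N \<in> \<int>"
  shows "real_of_int g ^ (s + k) * (fact s * fps_nth ((fps_twist \<theta> ^^ k) F) s) / fact N \<in> \<int>"
proof (induction k arbitrary: s)
  case (Suc k)
  let ?b = "\<lambda>s. fact s * fps_nth ((fps_twist \<theta> ^^ k) F) s"
  have "real_of_int g ^ (s + Suc k) * (fact s * fps_nth ((fps_twist \<theta> ^^ Suc k) F) s) / fact N
      = real_of_int g ^ (Suc s + k) * ?b (Suc s) / fact N
        - (real_of_int g * \<theta>) * (real_of_int g ^ (s + k) * ?b s / fact N)"
    unfolding funpow.simps comp_def fact_nth_fps_twist by (simp add: field_simps del: fact_Suc)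
  also have "\<dots> \<in> \<int>"
    by (intro Ints_diff Ints_mult Suc g\<theta>)
  finally show ?case .
qed (use F in simp)

lemma poly_1_eq_sum: "degree p \<le> N \<Longrightarrow> poly p 1 = (\<Sum>s\<le>N. coeff (p :: 'a :: comm_semiring_1 poly) s)"
  unfolding poly_altdef power_one mult_1_right
  by (rule sum.mono_neutral_left) (auto simp: coeff_eq_0)

text \<open>For s <= N the quotient N!/s! is an integer, so the division by N! in the hypothesis
  also removes the denominator s!. The spare power of g is at least 0 because s + k <= N +
  K.\<close>

lemma poly_1_twist_funpow_integral:
  assumes g\<theta>: "real_of_int g * \<theta> \<in> \<int>" and deg: "degree P \<le> N"
    and P: "\<And>s. real_of_int g ^ s * (fact s * coeff P s) / fact N \<in> \<int>" and "k \<le> K"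
  shows "real_of_int g ^ (N + K) * poly ((twist \<theta> ^^ k) P) 1 \<in> \<int>"
proof -
  let ?T = "(twist \<theta> ^^ k) P"
  have deg': "degree ?T \<le> N" using degree_twist_funpow deg order_trans by blast
  have "real_of_int g ^ (N + K) * poly ?T 1
      = (\<Sum>s\<le>N. real_of_int g ^ (N - s + (K - k)) * (fact N / fact s) *
          (real_of_int g ^ (s + k) * (fact s * coeff ?T s) / fact N))"
    unfolding poly_1_eq_sum[OF deg'] sum_distrib_left
  proof (rule sum.cong[OF refl])
    fix s assume "s \<in> {..N}"
    then have e: "N + K = (N - s + (K - k)) + (s + k)" using \<open>k \<le> K\<close> by simp
    show "real_of_int g ^ (N + K) * coeff ?T s = real_of_int g ^ (N - s + (K - k)) *
        (fact N / fact s) * (real_of_int g ^ (s + k) * (fact s * coeff ?T s) / fact N)"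
      by (subst e, subst power_add) simp
  qed
  also have "\<dots> \<in> \<int>"
  proof (intro Ints_sum Ints_mult)
    fix s assume "s \<in> {..N}"
    then have "(fact s :: int) dvd fact N" by (simp add: fact_dvd)
    then obtain z :: int where "fact N = fact s * z" by (elim dvdE)
    then have "(fact N :: real) = fact s * of_int z"
      by (metis of_int_fact of_int_mult)
    then show "(fact N / fact s :: real) \<in> \<int>" by simp
    show "real_of_int g ^ (s + k) * (fact s * coeff ?T s) / fact N \<in> \<int>"
      using fps_twist_funpow_integral[OF g\<theta>, of "fps_of_poly P" N s k] P
      by (simp flip: fps_of_poly_twist_funpow)
  qed simp
  finally show ?thesis .
qed

text \<open>Since (s + a)! >= s! a!, the part of the series from index a on is at most C c^a / a!
  times the exponential series of c.\<close>

lemma exp_tail_bound: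
  fixes r :: "nat \<Rightarrow> real"
  assumes sums: "r sums S" and bound: "\<And>s. \<bar>fact s * r s\<bar> \<le> C * c ^ s" and "0 \<le> c" "0 \<le> C"
    and zero: "\<And>s. s < a \<Longrightarrow> r s = 0"
  shows "\<bar>S\<bar> \<le> C * c ^ a * exp c / fact a"
proof -
  have "(\<lambda>s. r (s + a)) sums S"
    using sums_iff_shift'[of r a S] sums zero by simp
  moreover have le: "\<bar>r (s + a)\<bar> \<le> C * c ^ a / fact a * (c ^ s / fact s)" for s
  proof -
    have "fact s * fact a \<le> (fact (s + a) :: real)"
      using fact_fact_dvd_fact[of s a, where 'a = nat] dvd_imp_le[of "fact s * fact a" "fact (s + a) :: nat"]
      by (metis fact_ge_zero fact_nonzero neq0_conv of_nat_fact of_nat_le_iff of_nat_mult)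
    have "\<bar>r (s + a)\<bar> = \<bar>fact (s + a) * r (s + a)\<bar> / fact (s + a)"
      by (simp add: abs_mult)
    also have "\<dots> \<le> C * c ^ (s + a) / fact (s + a)"
      by (intro divide_right_mono bound) simp
    also have "\<dots> \<le> C * c ^ (s + a) / (fact s * fact a)"
      using \<open>fact s * fact a \<le> fact (s + a)\<close> assms(3,4) by (intro divide_left_mono) auto
    finally show ?thesis by (simp add: power_add mult_ac)
  qed
  moreover have "(\<lambda>s. C * c ^ a / fact a * (c ^ s / fact s)) sums (C * c ^ a / fact a * exp c)"
    using exp_converges[of c] by (intro sums_mult) (simp add: field_simps)
  ultimately have "S \<le> C * c ^ a / fact a * exp c" "- S \<le> C * c ^ a / fact a * exp c"
    by (intro sums_le[of _ _ S] sums_le[of "\<lambda>s. - r (s + a)" _ "- S"] sums_minus; force simp: abs_le_iff)+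
  then show ?thesis by simp
qed

lemma sums_fps_exp_mult_poly:
  "fps_nth (fps_exp \<theta> * fps_of_poly q) sums (exp \<theta> * poly q (1 :: real))"
proof -
  have "coeff q sums poly q 1"
    using sums_finite[of "{..degree q}" "coeff q"] by (simp add: poly_altdef coeff_eq_0)
  moreover have "summable (\<lambda>n. norm (coeff q n))"
    by (rule summable_finite[of "{..degree q}"]) (auto simp: coeff_eq_0)
  moreover have "(\<lambda>n. \<theta> ^ n / fact n) sums exp \<theta>"
    using exp_converges[of \<theta>] by (simp add: field_simps)
  moreover have "summable (\<lambda>n. norm (\<theta> ^ n / fact n))"
    using summable_norm_exp[of \<theta>] by (simp add: field_simps)
  ultimately have "(\<lambda>k. \<Sum>i\<le>k. \<theta> ^ i / fact i * coeff q (k - i)) sums (exp \<theta> * poly q 1)"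
    using Cauchy_product_sums[of "\<lambda>n. \<theta> ^ n / fact n" "coeff q"] by (simp add: sums_iff)
  moreover have "fps_nth (fps_exp \<theta> * fps_of_poly q) = (\<lambda>k. \<Sum>i\<le>k. \<theta> ^ i / fact i * coeff q (k - i))"
    by (simp add: fun_eq_iff fps_mult_nth atLeast0AtMost)
  ultimately show ?thesis by simp
qed

section \<open>The auxiliary polynomial, its truncations and their remainders\<close>

text \<open>
  The polynomial \<open>Q\<close> below has coefficients \<open>q k N!/k!\<close>, supported on \<open>{N + 1 - U..N}\<close>, so that
  \<open>|Q\<^sup>(\<^sup>k\<^sup>)(1)|\<close> is about \<open>N\<^sup>U\<close> only.
\<close>

locale truncated_approximation =
  fixes q :: "nat \<Rightarrow> int" and H N U :: nat
  assumes q_bound: "\<And>k. \<bar>q k\<bar> \<le> int H"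
    and q_support: "\<And>k. q k \<noteq> 0 \<Longrightarrow> N + 1 \<le> k + U \<and> k \<le> N"
    and N2: "2 \<le> N"
begin

definition Q :: "real poly"
  where "Q = (\<Sum>k\<le>N. monom (real_of_int (q k) * fact N / fact k) k)"

definition approx :: "real \<Rightarrow> real poly"
  where "approx \<theta> = truncate_fps (Suc N) (fps_exp \<theta> * fps_of_poly Q)"

lemma coeff_Q: "coeff Q k = real_of_int (q k) * fact N / fact k"
  using q_support[of k]
  by (cases "k \<le> N") (auto simp: Q_def coeff_sum if_distrib[of "\<lambda>p. coeff p _"] cong: if_cong)

lemma degree_Q: "degree Q \<le> N"
  by (rule degree_le) (use coeff_Q q_support in fastforce)

text \<open>The normalization N!/k! of Q turns the coefficients of the product into binomial sums.
  Their vanishing is thus a linear equation in the integers \<open>q k\<close>, to which Siegel's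
  lemma applies.\<close>

lemma fact_nth_exp_Q:
  "fact s * fps_nth (fps_exp \<theta> * fps_of_poly Q) s
    = fact N * (\<Sum>k\<le>s. real (s choose k) * real_of_int (q k) * \<theta> ^ (s - k))"
proof -
  have "fact s * fps_nth (fps_of_poly Q * fps_exp \<theta>) s
      = (\<Sum>k\<le>s. fact s * (coeff Q k * (\<theta> ^ (s - k) / fact (s - k))))"
    by (simp add: fps_mult_nth atLeast0AtMost sum_distrib_left)
  also have "\<dots> = (\<Sum>k\<le>s. fact N * (real (s choose k) * real_of_int (q k) * \<theta> ^ (s - k)))"
    by (rule sum.cong) (simp_all add: coeff_Q binomial_fact field_simps)
  finally show ?thesis by (simp add: sum_distrib_left mult.commute[of "fps_exp \<theta>"])
qed

lemma fact_nth_exp_Q_bound: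
  "\<bar>fact s * fps_nth (fps_exp \<theta> * fps_of_poly Q) s\<bar> \<le> fact N * real H * (1 + \<bar>\<theta>\<bar>) ^ s"
proof -
  have "\<bar>\<Sum>k\<le>s. real (s choose k) * real_of_int (q k) * \<theta> ^ (s - k)\<bar>
      \<le> (\<Sum>k\<le>s. \<bar>real (s choose k) * real_of_int (q k) * \<theta> ^ (s - k)\<bar>)"
    by (rule sum_abs)
  also have "\<dots> \<le> (\<Sum>k\<le>s. real H * (real (s choose k) * 1 ^ k * \<bar>\<theta>\<bar> ^ (s - k)))"
  proof (rule sum_mono)
    fix k
    have "\<bar>real_of_int (q k)\<bar> \<le> real H" using q_bound[of k] by linarith
    from mult_right_mono[OF this, of "real (s choose k) * \<bar>\<theta>\<bar> ^ (s - k)"]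
    show "\<bar>real (s choose k) * real_of_int (q k) * \<theta> ^ (s - k)\<bar>
        \<le> real H * (real (s choose k) * 1 ^ k * \<bar>\<theta>\<bar> ^ (s - k))"
      by (simp add: abs_mult power_abs mult_ac)
  qed
  also have "\<dots> = real H * (1 + \<bar>\<theta>\<bar>) ^ s"
    by (simp add: binomial_ring sum_distrib_left)
  finally show ?thesis
    unfolding fact_nth_exp_Q by (simp add: abs_mult mult.assoc)
qed

lemma coeff_approx: "coeff (approx \<theta>) s = (if s \<le> N then fps_nth (fps_exp \<theta> * fps_of_poly Q) s else 0)"
  by (simp add: approx_def coeff_truncate_fps del: fps_exp_nth)

lemma degree_approx: "degree (approx \<theta>) \<le> N"
  by (rule degree_le) (simp add: coeff_approx)

lemma approx_0: "approx 0 = Q"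
  by (rule poly_eqI) (use coeff_eq_0[of Q] degree_Q in \<open>auto simp: coeff_approx\<close>)

lemma integral_approx:
  assumes g\<theta>: "real_of_int g * \<theta> \<in> \<int>" and "k \<le> K"
  shows "real_of_int g ^ (N + K) * poly ((twist \<theta> ^^ k) (approx \<theta>)) 1 \<in> \<int>"
proof (rule poly_1_twist_funpow_integral[OF g\<theta> degree_approx _ \<open>k \<le> K\<close>])
  fix s
  have "real_of_int g ^ s * (\<Sum>k\<le>s. real (s choose k) * real_of_int (q k) * \<theta> ^ (s - k))
      = (\<Sum>k\<le>s. real (s choose k) * real_of_int (q k) * (real_of_int g ^ k * (real_of_int g * \<theta>) ^ (s - k)))"
    unfolding sum_distrib_left
  proof (rule sum.cong[OF refl])
    fix k assume "k \<in> {..s}"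
    then have "real_of_int g ^ s = real_of_int g ^ k * real_of_int g ^ (s - k)"
      by (simp flip: power_add)
    then show "real_of_int g ^ s * (real (s choose k) * real_of_int (q k) * \<theta> ^ (s - k))
        = real (s choose k) * real_of_int (q k) * (real_of_int g ^ k * (real_of_int g * \<theta>) ^ (s - k))"
      by (simp add: power_mult_distrib)
  qed
  also have "\<dots> \<in> \<int>"
    by (intro Ints_sum Ints_mult Ints_power g\<theta>) auto
  finally show "real_of_int g ^ s * (fact s * coeff (approx \<theta>) s) / fact N \<in> \<int>"
    by (simp add: coeff_approx fact_nth_exp_Q del: fps_exp_nth)
qed

text \<open>Only coefficients with N - s <= U - 1 + k survive, and there N!/s! is at most N^(N - s).
  The sum has N + 1 <= N^2 terms, which raises the exponent from U - 1 + K to U + K + 1.\<close>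

lemma poly_Q_bound:
  assumes "k \<le> K" "1 \<le> U"
  shows "\<bar>poly ((twist 0 ^^ k) Q) 1\<bar> \<le> real H * real N ^ (U + K + 1)"
proof -
  let ?T = "(twist 0 ^^ k) Q"
  have "\<bar>fact s * fps_nth (fps_of_poly Q) s\<bar> \<le> fact N * real H * 1 ^ s" for s
    using fact_nth_exp_Q_bound[of s 0] by simp
  then have "\<bar>fact s * fps_nth ((fps_twist 0 ^^ k) (fps_of_poly Q)) s\<bar> \<le> fact N * real H * 1 ^ s * (1 + \<bar>0\<bar>) ^ k" for s
    by (rule fps_twist_funpow_bound) simp_all
  then have b: "\<bar>fact s * coeff ?T s\<bar> \<le> fact N * real H" for s
    by (simp flip: fps_of_poly_twist_funpow)
  have "fps_X ^ (N + 1 - U) dvd fps_of_poly Q"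
    unfolding fps_X_power_dvd_iff using q_support by (fastforce simp: coeff_Q)
  from fps_twist_funpow_dvd[OF this, of k 0]
  have z: "coeff ?T s = 0" if "s < N + 1 - U - k" for s
    using that by (simp add: fps_X_power_dvd_iff flip: fps_of_poly_twist_funpow)
  have le: "\<bar>coeff ?T s\<bar> \<le> real H * real N ^ (U - 1 + K)" if "s \<le> N" for s
  proof (cases "s < N + 1 - U - k")
    case False
    have "fact s * \<bar>coeff ?T s\<bar> * real N ^ s \<le> (fact N * real N ^ s) * real H"
      using mult_right_mono[OF b[of s], of "real N ^ s"] by (simp add: abs_mult mult_ac)
    also have "\<dots> \<le> fact s * real N ^ N * real H"
      by (intro mult_right_mono fact_mult_power_le) simp
    also have "real N ^ N = real N ^ (N - s) * real N ^ s"
      using that by (simp flip: power_add)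
    finally have "\<bar>coeff ?T s\<bar> \<le> real N ^ (N - s) * real H"
      using N2 by simp
    also have "\<dots> \<le> real N ^ (U - 1 + K) * real H"
      using False N2 assms by (intro mult_right_mono power_increasing) auto
    finally show ?thesis by (simp add: mult.commute)
  qed (simp add: z)
  have "\<bar>poly ?T 1\<bar> \<le> (\<Sum>s\<le>N. \<bar>coeff ?T s\<bar>)"
    unfolding poly_1_eq_sum[OF order_trans[OF degree_twist_funpow degree_Q]] by (rule sum_abs)
  also have "\<dots> \<le> (\<Sum>s\<le>N. real H * real N ^ (U - 1 + K))"
    by (intro sum_mono le) simp
  also have "\<dots> = (real N + 1) * (real H * real N ^ (U - 1 + K))"
    by simp
  also have "\<dots> \<le> (real N)\<^sup>2 * (real H * real N ^ (U - 1 + K))"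
  proof (rule mult_right_mono)
    have N2': "2 \<le> real N" using N2 by simp
    then have "real N * 2 \<le> real N * real N" by (intro mult_left_mono) auto
    then show "real N + 1 \<le> (real N)\<^sup>2" unfolding power2_eq_square using N2' by linarith
  qed simp
  also have "\<dots> = real H * real N ^ (U + K + 1)"
  proof -
    have "U + K + 1 = 2 + (U - 1 + K)" using assms(2) by simp
    then show ?thesis by (simp only: power_add mult_ac)
  qed
  finally show ?thesis .
qed

lemma remainder_order:
  assumes vanish: "\<And>s. N < s \<Longrightarrow> s \<le> N + w \<Longrightarrow>
      (\<Sum>k\<le>s. real (s choose k) * real_of_int (q k) * \<theta> ^ (s - k)) = 0"
  shows "fps_X ^ (N + 1 + w) dvd fps_exp \<theta> * fps_of_poly Q - fps_of_poly (approx \<theta>)"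
  unfolding fps_X_power_dvd_iff
proof (intro allI impI)
  fix s assume s: "s < N + 1 + w"
  show "fps_nth (fps_exp \<theta> * fps_of_poly Q - fps_of_poly (approx \<theta>)) s = 0"
  proof (cases "s \<le> N")
    case False
    have "fact s * fps_nth (fps_exp \<theta> * fps_of_poly Q) s = 0"
      unfolding fact_nth_exp_Q using vanish[of s] False s by simp
    then show ?thesis using False by (simp add: coeff_approx del: fps_exp_nth)
  qed (simp add: coeff_approx del: fps_exp_nth)
qed

text \<open>Twisting k times lowers the order of the remainder from N + 1 + w to a = N + 1 + w - k.
  \<open>exp_tail_bound\<close> then applies, and N!/a! <= N^k / N^(w + 1) supplies the
  decay.\<close>

lemma remainder_bound:
  assumes ord: "fps_X ^ (N + 1 + w) dvd fps_exp \<theta> * fps_of_poly Q - fps_of_poly (approx \<theta>)"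
    and "\<bar>\<theta>\<bar> \<le> \<rho>" "k \<le> K" "k \<le> N" "w \<le> W"
  shows "\<bar>poly ((twist 0 ^^ k) Q) 1 * exp \<theta> - poly ((twist \<theta> ^^ k) (approx \<theta>)) 1\<bar>
    \<le> real H * (1 + \<rho>) ^ (2 * K + N + 1 + W) * exp (1 + \<rho>) * real N ^ K / real N ^ (w + 1)"
proof -
  let ?R = "fps_exp \<theta> * fps_of_poly Q - fps_of_poly (approx \<theta>)"
  let ?a = "N + 1 + w - k"
  have "fps_twist 0 = fps_deriv" by (simp add: fun_eq_iff fps_twist_def)
  then have R: "(fps_twist \<theta> ^^ k) ?R
      = fps_exp \<theta> * fps_of_poly ((twist 0 ^^ k) Q) - fps_of_poly ((twist \<theta> ^^ k) (approx \<theta>))"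
    by (simp add: fps_twist_funpow_diff fps_twist_funpow_exp_mult fps_of_poly_twist_funpow)
  have poly_sums: "fps_nth (fps_of_poly p) sums poly p 1" for p :: "real poly"
    using sums_fps_exp_mult_poly[of 0 p] by simp
  have sums: "fps_nth ((fps_twist \<theta> ^^ k) ?R) sums
      (exp \<theta> * poly ((twist 0 ^^ k) Q) 1 - poly ((twist \<theta> ^^ k) (approx \<theta>)) 1)"
    using sums_diff[OF sums_fps_exp_mult_poly poly_sums] unfolding R fps_sub_nth[symmetric] .
  have c: "0 \<le> \<rho>" using assms(2) by linarith
  \<comment> \<open>Truncation leaves each coefficient unchanged or sets it to 0, so the remainder
    inherits the coefficient bound of the full product.\<close>
  have "\<bar>fact s * fps_nth ?R s\<bar> \<le> fact N * real H * (1 + \<rho>) ^ s" for s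
  proof -
    have "\<bar>fact s * fps_nth ?R s\<bar> \<le> \<bar>fact s * fps_nth (fps_exp \<theta> * fps_of_poly Q) s\<bar>"
      by (simp add: coeff_approx del: fps_exp_nth)
    also have "\<dots> \<le> fact N * real H * (1 + \<bar>\<theta>\<bar>) ^ s"
      by (rule fact_nth_exp_Q_bound)
    also have "\<dots> \<le> fact N * real H * (1 + \<rho>) ^ s"
      using assms(2) by (intro mult_left_mono power_mono) auto
    finally show ?thesis .
  qed
  then have b: "\<bar>fact s * fps_nth ((fps_twist \<theta> ^^ k) ?R) s\<bar>
      \<le> fact N * real H * (1 + \<rho>) ^ s * (1 + \<rho> + \<bar>\<theta>\<bar>) ^ k" for s
    by (rule fps_twist_funpow_bound) (use c in auto)
  have "\<bar>exp \<theta> * poly ((twist 0 ^^ k) Q) 1 - poly ((twist \<theta> ^^ k) (approx \<theta>)) 1\<bar>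
      \<le> (fact N * real H * (1 + \<rho> + \<bar>\<theta>\<bar>) ^ k) * (1 + \<rho>) ^ ?a * exp (1 + \<rho>) / fact ?a"
  proof (rule exp_tail_bound[OF sums])
    show "\<bar>fact s * fps_nth ((fps_twist \<theta> ^^ k) ?R) s\<bar>
        \<le> (fact N * real H * (1 + \<rho> + \<bar>\<theta>\<bar>) ^ k) * (1 + \<rho>) ^ s" for s
      using b[of s] by (simp add: mult_ac)
    show "fps_nth ((fps_twist \<theta> ^^ k) ?R) s = 0" if "s < ?a" for s
      using fps_twist_funpow_dvd[OF ord, of k \<theta>] that unfolding fps_X_power_dvd_iff by blast
  qed (use c in auto)
  also have "\<dots> = real H * exp (1 + \<rho>) * (((1 + \<rho> + \<bar>\<theta>\<bar>) ^ k * (1 + \<rho>) ^ ?a) * (fact N / fact ?a))"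
    by simp
  also have "\<dots> \<le> real H * exp (1 + \<rho>) * ((1 + \<rho>) ^ (2 * K + N + 1 + W) * (real N ^ K / real N ^ (w + 1)))"
  proof (intro mult_left_mono mult_mono)
    \<comment> \<open>Each factor 1 + \<rho> + |\<theta>| costs two factors 1 + \<rho>, which
      explains the summand 2 K of the exponent.\<close>
    have "(1 + \<rho> + \<bar>\<theta>\<bar>) ^ k \<le> ((1 + \<rho>)\<^sup>2) ^ k"
    proof (rule power_mono)
      have "1 + \<rho> + \<bar>\<theta>\<bar> \<le> 1 + 2 * \<rho> + \<rho>\<^sup>2" using assms(2) zero_le_power2[of \<rho>] by linarith
      then show "1 + \<rho> + \<bar>\<theta>\<bar> \<le> (1 + \<rho>)\<^sup>2" by (simp add: power2_eq_square algebra_simps)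
    qed (use c in auto)
    then have "(1 + \<rho> + \<bar>\<theta>\<bar>) ^ k * (1 + \<rho>) ^ ?a \<le> (1 + \<rho>) ^ (2 * k + ?a)"
      using c by (simp add: power_add power_mult mult_right_mono)
    also have "\<dots> \<le> (1 + \<rho>) ^ (2 * K + N + 1 + W)"
      using c assms by (intro power_increasing) auto
    finally show "(1 + \<rho> + \<bar>\<theta>\<bar>) ^ k * (1 + \<rho>) ^ ?a \<le> (1 + \<rho>) ^ (2 * K + N + 1 + W)" .
    have "fact N * real N ^ ?a * real N ^ k \<le> fact ?a * real N ^ N * real N ^ k"
      by (intro mult_right_mono fact_mult_power_le) simp
    also have "real N ^ ?a * real N ^ k = real N ^ (w + 1) * real N ^ N"
    proof -
      have "?a + k = (w + 1) + N" using \<open>k \<le> N\<close> by simp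
      then show ?thesis by (metis power_add)
    qed
    then have "fact N * real N ^ ?a * real N ^ k = (fact N * real N ^ (w + 1)) * real N ^ N"
      by (simp add: mult.assoc)
    finally have "fact N * real N ^ (w + 1) \<le> fact ?a * real N ^ k"
      using N2 by simp
    also have "\<dots> \<le> fact ?a * real N ^ K"
      using N2 \<open>k \<le> K\<close> by (intro mult_left_mono power_increasing) auto
    finally show "fact N / fact ?a \<le> real N ^ K / real N ^ (w + 1)"
      using N2 by (simp add: divide_simps mult_ac)
  qed (use c in auto)
  finally show ?thesis by (simp add: mult_ac)
qed

end

text \<open>If all combinations vanished, the orders at 0 and 1 would be at least N + 1 - U - m, the
  terms N + 1 + w i - m for i = 1..m, and K + 1 - m. With the given U and K these add up to (m + 1)
  N + 2, more than \<open>zero_estimate\<close> allows.\<close>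

lemma (in truncated_approximation) nonzero_combination:
  fixes \<beta> :: "nat \<Rightarrow> int"
  assumes inj: "inj_on \<theta> {..m}" and \<theta>0: "\<theta> 0 = 0" and Q0: "Q \<noteq> 0"
    and ord: "\<And>i. 0 < i \<Longrightarrow> i \<le> m \<Longrightarrow> fps_X ^ (N + 1 + w i) dvd
      fps_exp (\<theta> i) * fps_of_poly Q - fps_of_poly (approx (\<theta> i))"
    and U: "U = (\<Sum>i = 1..m. w i) + D" and K: "K = D + m * (m + 1)" and j: "j \<le> m" "\<beta> j \<noteq> 0"
  shows "\<exists>k\<le>K. (\<Sum>i\<le>m. real_of_int (\<beta> i) * poly ((twist (\<theta> i) ^^ k) (approx (\<theta> i))) 1) \<noteq> 0"
proof (rule ccontr)
  assume "\<not> ?thesis"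
  then have rel: "(\<Sum>i\<le>m. real_of_int (\<beta> i) * poly ((twist (\<theta> i) ^^ k) (approx (\<theta> i))) 1) = 0"
    if "k \<le> K" for k using that by blast
  define e where "e = (\<lambda>i. if i = 0 then N + 1 - U else N + 1 + w i)"
  have exp_inv: "fps_exp (- x) * fps_exp x = 1" for x :: real
    by (simp flip: fps_exp_add_mult)
  have dvd: "fps_X ^ e i dvd fps_of_poly (approx (\<theta> 0)) - fps_exp (- \<theta> i) * fps_of_poly (approx (\<theta> i))"
    if "0 < i" "i \<le> m" for i
  proof -
    have "fps_of_poly (approx (\<theta> 0)) - fps_exp (- \<theta> i) * fps_of_poly (approx (\<theta> i))
        = fps_exp (- \<theta> i) * (fps_exp (\<theta> i) * fps_of_poly Q - fps_of_poly (approx (\<theta> i)))"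
      by (simp add: approx_0 \<theta>0 right_diff_distrib exp_inv flip: mult.assoc)
    then show ?thesis using ord[OF that] that by (simp add: e_def dvd_mult)
  qed
  have nz: "approx (\<theta> i) \<noteq> 0" if "i \<le> m" for i
  proof (cases "i = 0")
    case False
    show ?thesis
    proof
      assume "approx (\<theta> i) = 0"
      \<comment> \<open>A nonzero polynomial of degree at most N cannot have order N + 1 at
        0.\<close>
      then have "fps_X ^ (N + 1 + w i) dvd fps_of_poly Q"
        using dvd[of i] False that by (simp add: e_def approx_0 \<theta>0)
      then have "coeff Q (degree Q) = 0"
        using degree_Q unfolding fps_X_power_dvd_iff by simp
      then show False using Q0 by simp
    qed
  qed (simp add: approx_0 \<theta>0 Q0)
  have "fps_X ^ e 0 dvd fps_of_poly (approx (\<theta> 0))"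
    unfolding fps_X_power_dvd_iff using q_support by (fastforce simp: e_def approx_0 \<theta>0 coeff_Q)
  then have "(\<Sum>i\<le>m. e i - m) + (Suc K - m) \<le> Suc m * N"
    using zero_estimate[where \<theta> = \<theta> and P = "\<lambda>i. approx (\<theta> i)" and N = N and e = e and m = m and j = j
      and \<beta> = "\<lambda>i. real_of_int (\<beta> i)" and K = K, OF inj \<theta>0 nz degree_approx _ dvd j(1) _ rel] j(2)
    by simp
  \<comment> \<open>The count moves to integers because the natural subtractions truncate; from here
    only lower bounds for the orders are needed.\<close>
  then have le: "(\<Sum>i\<le>m. int (e i - m)) + int (Suc K - m) \<le> int (Suc m * N)"
    by (metis of_nat_add of_nat_mono of_nat_sum)
  have "(\<Sum>i\<le>m. int (e i - m)) = int (e 0 - m) + (\<Sum>i = 1..m. int (e i - m))"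
    by (simp add: sum.atLeast_Suc_atMost flip: atLeast0AtMost)
  moreover have "(\<Sum>i = 1..m. int (e i - m)) \<ge> (\<Sum>i = 1..m. int N + 1 - int m + int (w i))"
    by (rule sum_mono) (auto simp: e_def)
  moreover have "(\<Sum>i = 1..m. int N + 1 - int m + int (w i)) = int m * (int N + 1 - int m) + (int U - int D)"
    by (simp add: sum.distrib U)
  moreover have "int (e 0 - m) \<ge> int N + 1 - int U - int m" by (simp add: e_def)
  moreover have "int (Suc K - m) \<ge> int D + int m * int m + 1" by (simp add: K algebra_simps)
  ultimately show False using le by (simp add: algebra_simps)
qed

text \<open>There is one equation for each pair (i, s) with N < s <= N + w i, made integral by the
  factor g^s. By the binomial theorem the absolute coefficients of each equation sum to at most (g
  (1 + \<rho>))^s.\<close>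

lemma siegel_exp:
  fixes \<theta> :: "nat \<Rightarrow> real" and g :: int
  assumes g: "1 \<le> g" and g\<theta>: "\<And>i. i \<in> I \<Longrightarrow> real_of_int g * \<theta> i \<in> \<int>" and I: "finite I"
    and \<rho>: "\<And>i. i \<in> I \<Longrightarrow> \<bar>\<theta> i\<bar> \<le> \<rho>" "0 \<le> \<rho>" and w: "\<And>i. i \<in> I \<Longrightarrow> w i \<le> W"
    and U: "U = (\<Sum>i\<in>I. w i) + D" "U \<le> N + 1"
    and H: "(real_of_int g * (1 + \<rho>)) ^ ((N + W) * (U - D)) < (real H + 1) ^ D"
  shows "\<exists>q. (\<exists>k. q k \<noteq> 0) \<and> (\<forall>k. \<bar>q k\<bar> \<le> int H) \<and> (\<forall>k. q k \<noteq> 0 \<longrightarrow> N + 1 \<le> k + U \<and> k \<le> N) \<and>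
    (\<forall>i\<in>I. \<forall>s. N < s \<longrightarrow> s \<le> N + w i \<longrightarrow>
      (\<Sum>k\<le>s. real (s choose k) * real_of_int (q k) * \<theta> i ^ (s - k)) = 0)"
proof -
  define t where "t = (\<lambda>i. \<lfloor>real_of_int g * \<theta> i\<rfloor>)"
  have t: "real_of_int (t i) = real_of_int g * \<theta> i" if "i \<in> I" for i
    using g\<theta>[OF that] by (simp add: t_def)
  define J where "J = Sigma I (\<lambda>i. {N + 1..N + w i})"
  \<comment> \<open>Unknown number k stands for the coefficient of index \<open>off + k\<close>, so
    that the U unknowns end exactly at index N.\<close>
  define off where "off = N + 1 - U"
  define a where "a = (\<lambda>(i, s) k. int (s choose (off + k)) * g ^ (off + k) * t i ^ (s - (off + k)))"
  let ?G = "real_of_int g * (1 + \<rho>)"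
  have G1: "1 \<le> ?G" using g \<rho>(2) mult_mono[of 1 "real_of_int g" 1 "1 + \<rho>"] by simp
  have cardJ: "card J = U - D" using I by (simp add: J_def U)
  have J: "finite J" using I by (simp add: J_def)
  have "real_of_int (\<Sum>k<U. \<bar>a j k\<bar>) \<le> ?G ^ (N + W)" if "j \<in> J" for j
  proof -
    obtain i s where j: "j = (i, s)" by (cases j)
    with that have i: "i \<in> I" and s: "N + 1 \<le> s" "s \<le> N + w i" by (auto simp: J_def)
    have "real_of_int (\<Sum>k<U. \<bar>a j k\<bar>)
        = (\<Sum>k<U. real (s choose (k + off)) * real_of_int g ^ (k + off) * (real_of_int g * \<bar>\<theta> i\<bar>) ^ (s - (k + off)))"
      using g by (simp add: a_def j abs_mult power_abs t[OF i] add.commute)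
    also have "\<dots> = (\<Sum>k = off..<U + off. real (s choose k) * real_of_int g ^ k * (real_of_int g * \<bar>\<theta> i\<bar>) ^ (s - k))"
      using sum.shift_bounds_nat_ivl[of "\<lambda>k. real (s choose k) * real_of_int g ^ k * (real_of_int g * \<bar>\<theta> i\<bar>) ^ (s - k)" 0 off U]
      by (simp add: atLeast0LessThan)
    also have "\<dots> \<le> (\<Sum>k\<le>s. real (s choose k) * real_of_int g ^ k * (real_of_int g * \<bar>\<theta> i\<bar>) ^ (s - k))"
      by (rule sum_mono2) (use U(2) s g in \<open>auto simp: off_def\<close>)
    also have "\<dots> = (real_of_int g + real_of_int g * \<bar>\<theta> i\<bar>) ^ s"
      by (simp add: binomial_ring)
    also have "\<dots> \<le> ?G ^ s"
      using g \<rho>(1)[OF i] by (intro power_mono) (auto simp: distrib_left intro!: mult_left_mono add_nonneg_nonneg)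
    also have "\<dots> \<le> ?G ^ (N + W)"
      using s w[OF i] G1 by (intro power_increasing) auto
    finally show ?thesis .
  qed
  moreover have "1 \<le> ?G ^ (N + W)" using G1 by simp
  moreover have "card J \<le> U" by (simp add: cardJ)
  moreover have "(?G ^ (N + W)) ^ card J < (real H + 1) ^ (U - card J)"
    using H U(1) by (simp add: cardJ power_mult)
  ultimately obtain p :: "nat \<Rightarrow> int" where p: "\<exists>k<U. p k \<noteq> 0" "\<forall>k<U. \<bar>p k\<bar> \<le> int H"
      "\<forall>j\<in>J. (\<Sum>k<U. a j k * p k) = 0"
    using siegel_lemma[OF J, where U = U and a = a and A = "?G ^ (N + W)" and H = H] by blast
  define q where "q = (\<lambda>k. if off \<le> k \<and> k \<le> N then p (k - off) else 0)"
  have offU: "off + U = N + 1" using U(2) by (simp add: off_def)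
  have "(\<Sum>k\<le>s. real (s choose k) * real_of_int (q k) * \<theta> i ^ (s - k)) = 0"
    if i: "i \<in> I" and s: "N < s" "s \<le> N + w i" for i s
  proof -
    have "real_of_int g ^ s * (\<Sum>k\<le>s. real (s choose k) * real_of_int (q k) * \<theta> i ^ (s - k))
        = (\<Sum>k\<le>s. real_of_int (int (s choose k) * g ^ k * t i ^ (s - k) * q k))"
      unfolding sum_distrib_left
    proof (rule sum.cong[OF refl])
      fix k assume "k \<in> {..s}"
      then have "real_of_int g ^ s = real_of_int g ^ k * real_of_int g ^ (s - k)"
        by (simp flip: power_add)
      then show "real_of_int g ^ s * (real (s choose k) * real_of_int (q k) * \<theta> i ^ (s - k))
          = real_of_int (int (s choose k) * g ^ k * t i ^ (s - k) * q k)"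
        by (simp add: t[OF i] power_mult_distrib)
    qed
    also have "\<dots> = real_of_int (\<Sum>k = off..<U + off. int (s choose k) * g ^ k * t i ^ (s - k) * q k)"
      unfolding of_int_sum by (rule sum.mono_neutral_right) (use offU s in \<open>auto simp: q_def\<close>)
    also have "(\<Sum>k = off..<U + off. int (s choose k) * g ^ k * t i ^ (s - k) * q k) = (\<Sum>k<U. a (i, s) k * p k)"
      using sum.shift_bounds_nat_ivl[of "\<lambda>k. int (s choose k) * g ^ k * t i ^ (s - k) * q k" 0 off U] offU
      by (simp add: atLeast0LessThan a_def q_def add.commute[of off] cong: sum.cong_simp)
    also have "\<dots> = 0" using p(3) i s by (simp add: J_def)
    finally show ?thesis using g by simp
  qed
  moreover have "\<exists>k. q k \<noteq> 0"
  proof -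
    from p(1) obtain k where "k < U" "p k \<noteq> 0" by blast
    then have "q (k + off) \<noteq> 0" using offU by (simp add: q_def)
    then show ?thesis ..
  qed
  moreover have "\<bar>q k\<bar> \<le> int H" for k
    using p(2) offU by (auto simp: q_def)
  moreover have "N + 1 \<le> k + U \<and> k \<le> N" if "q k \<noteq> 0" for k
    using that offU by (auto simp: q_def split: if_splits)
  ultimately show ?thesis by blast
qed

text \<open>The \<open>y i\<close> are the twisted truncations at 1, cleared of denominators by g^(N
  + K). The number k <= K of twists is the one given by \<open>nonzero_combination\<close>, so it
  depends on \<beta>.\<close>

lemma exp_approximations:
  fixes \<theta> :: "nat \<Rightarrow> real" and g :: int and \<beta> :: "nat \<Rightarrow> int"
  assumes g: "1 \<le> g" and g\<theta>: "\<And>i. i \<le> m \<Longrightarrow> real_of_int g * \<theta> i \<in> \<int>"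
    and inj: "inj_on \<theta> {..m}" and \<theta>0: "\<theta> 0 = 0"
    and \<rho>: "\<And>i. i \<le> m \<Longrightarrow> \<bar>\<theta> i\<bar> \<le> \<rho>" and w: "\<And>i. 0 < i \<Longrightarrow> i \<le> m \<Longrightarrow> w i \<le> W"
    and U: "U = (\<Sum>i = 1..m. w i) + D" "U \<le> N + 1" and D: "1 \<le> D"
    and K: "K = D + m * (m + 1)" "K \<le> N" and N: "2 \<le> N"
    and H: "(real_of_int g * (1 + \<rho>)) ^ ((N + W) * (U - D)) < (real H + 1) ^ D"
    and j: "j \<le> m" "\<beta> j \<noteq> 0"
  shows "\<exists>y :: nat \<Rightarrow> int. (\<Sum>i\<le>m. \<beta> i * y i) \<noteq> 0 \<and>
    \<bar>real_of_int (y 0)\<bar> \<le> real_of_int g ^ (N + K) * real H * real N ^ (U + K + 1) \<and>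
    (\<forall>i. 0 < i \<longrightarrow> i \<le> m \<longrightarrow> \<bar>real_of_int (y 0) * exp (\<theta> i) - real_of_int (y i)\<bar>
      \<le> real_of_int g ^ (N + K) * real H * (1 + \<rho>) ^ (2 * K + N + 1 + W) * exp (1 + \<rho>)
          * real N ^ K / real N ^ (w i + 1))"
proof -
  have "0 \<le> \<rho>" using \<rho>[of 0] by simp
  have I: "i \<le> m" and w': "w i \<le> W" if "i \<in> {1..m}" for i
    using that w by auto
  from siegel_exp[where I = "{1..m}" and \<theta> = \<theta>, OF g g\<theta>[OF I] finite_atLeastAtMost \<rho>[OF I] \<open>0 \<le> \<rho>\<close> w' U H]
  obtain q :: "nat \<Rightarrow> int" where q: "\<exists>k. q k \<noteq> 0" "\<And>k. \<bar>q k\<bar> \<le> int H"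
    "\<And>k. q k \<noteq> 0 \<Longrightarrow> N + 1 \<le> k + U \<and> k \<le> N"
    and van: "\<And>i s. i \<in> {1..m} \<Longrightarrow> N < s \<Longrightarrow> s \<le> N + w i \<Longrightarrow>
      (\<Sum>k\<le>s. real (s choose k) * real_of_int (q k) * \<theta> i ^ (s - k)) = 0"
    by blast
  interpret truncated_approximation q H N U
    by unfold_locales (use q(2,3) N in auto)
  have Q0: "Q \<noteq> 0"
  proof
    assume "Q = 0"
    then have "real_of_int (q k) * fact N / fact k = 0" for k using coeff_Q[of k] by simp
    with q(1) show False by simp
  qed
  have ord: "fps_X ^ (N + 1 + w i) dvd fps_exp (\<theta> i) * fps_of_poly Q - fps_of_poly (approx (\<theta> i))"
    if "0 < i" "i \<le> m" for i
    by (rule remainder_order) (use van that in auto)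
  obtain k where k: "k \<le> K" "(\<Sum>i\<le>m. real_of_int (\<beta> i) * poly ((twist (\<theta> i) ^^ k) (approx (\<theta> i))) 1) \<noteq> 0"
    using nonzero_combination[where \<theta> = \<theta> and w = w and \<beta> = \<beta> and m = m, OF inj \<theta>0 Q0 ord U(1) K(1) j] by blast
  let ?p = "\<lambda>i. poly ((twist (\<theta> i) ^^ k) (approx (\<theta> i))) 1"
  let ?g = "real_of_int g ^ (N + K)"
  \<comment> \<open>The floor is exact, since these values are integers by
    \<open>integral_approx\<close>.\<close>
  define y where "y = (\<lambda>i. \<lfloor>?g * ?p i\<rfloor>)"
  have y: "real_of_int (y i) = ?g * ?p i" if "i \<le> m" for i
    using integral_approx[OF g\<theta>[OF that] k(1)] by (simp add: y_def)
  have g0: "0 < ?g" using g by simp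
  have sum_eq: "real_of_int (\<Sum>i\<le>m. \<beta> i * y i) = ?g * (\<Sum>i\<le>m. real_of_int (\<beta> i) * ?p i)"
    by (simp add: y sum_distrib_left mult.left_commute)
  have "(\<Sum>i\<le>m. \<beta> i * y i) \<noteq> 0"
  proof
    assume "(\<Sum>i\<le>m. \<beta> i * y i) = 0"
    then have "?g * (\<Sum>i\<le>m. real_of_int (\<beta> i) * ?p i) = 0"
      unfolding sum_eq[symmetric] by simp
    with k(2) g show False unfolding mult_eq_0_iff by simp
  qed
  moreover have "\<bar>real_of_int (y 0)\<bar> \<le> ?g * real H * real N ^ (U + K + 1)"
  proof -
    have "\<bar>?p 0\<bar> \<le> real H * real N ^ (U + K + 1)"
      using poly_Q_bound[OF k(1)] U(1) D by (simp add: \<theta>0 approx_0)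
    from mult_left_mono[OF this, of ?g] g0 show ?thesis by (simp add: y abs_mult mult.assoc)
  qed
  moreover have "\<bar>real_of_int (y 0) * exp (\<theta> i) - real_of_int (y i)\<bar>
      \<le> ?g * real H * (1 + \<rho>) ^ (2 * K + N + 1 + W) * exp (1 + \<rho>) * real N ^ K / real N ^ (w i + 1)"
    if i: "0 < i" "i \<le> m" for i
  proof -
    have "real_of_int (y 0) * exp (\<theta> i) - real_of_int (y i) = ?g * (?p 0 * exp (\<theta> i) - ?p i)"
      using i by (simp add: y right_diff_distrib)
    moreover have "\<bar>?p 0 * exp (\<theta> i) - ?p i\<bar>
      \<le> real H * (1 + \<rho>) ^ (2 * K + N + 1 + W) * exp (1 + \<rho>) * real N ^ K / real N ^ (w i + 1)"
      using remainder_bound[OF ord[OF i] \<rho>[OF i(2)] k(1) _ w[OF i]] k(1) K(2) by (simp add: \<theta>0 approx_0)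
    from mult_left_mono[OF this, of ?g]
    have "?g * \<bar>?p 0 * exp (\<theta> i) - ?p i\<bar> \<le> ?g * real H * (1 + \<rho>) ^ (2 * K + N + 1 + W) * exp (1 + \<rho>)
        * real N ^ K / real N ^ (w i + 1)"
      using g0 by (simp add: mult.assoc)
    ultimately show ?thesis using g0 by (simp add: abs_mult)
  qed
  ultimately show ?thesis by blast
qed

section \<open>Choice of parameters\<close>

text \<open>This is t <= exp t at t = \<tau>/16, raised to the eighth power; 512 is chosen because
  512^4 = 16^9.\<close>

lemma power4_le_exp_half:
  assumes "512 \<le> \<tau>" shows "16 * \<tau> ^ 4 \<le> exp (\<tau> / 2 :: real)"
proof -
  have "16 ^ 8 * (16 * \<tau> ^ 4) \<le> 512 ^ 4 * \<tau> ^ 4" by simp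
  also have "\<dots> \<le> \<tau> ^ 4 * \<tau> ^ 4"
    using assms by (intro mult_right_mono power_mono) auto
  also have "\<dots> = 16 ^ 8 * (\<tau> / 16) ^ 8" by (simp add: power_divide flip: power_add)
  also have "(\<tau> / 16) ^ 8 \<le> exp (\<tau> / 16) ^ 8"
  proof (rule power_mono)
    show "\<tau> / 16 \<le> exp (\<tau> / 16)" using exp_ge_add_one_self[of "\<tau> / 16"] by linarith
  qed (use assms in simp)
  also have "exp (\<tau> / 16) ^ 8 = exp (\<tau> / 2)" by (simp flip: exp_of_nat_mult)
  finally show ?thesis by simp
qed

text \<open>Cubing t <= exp t at t = \<tau>/60 suffices, since 60^3 < 512^2.\<close>

lemma ln_le_div_20:
  assumes "512 \<le> (\<tau> :: real)" shows "ln \<tau> \<le> \<tau> / 20"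
proof -
  have "60 ^ 3 * \<tau> \<le> 512\<^sup>2 * \<tau>" using assms by simp
  also have "\<dots> \<le> \<tau>\<^sup>2 * \<tau>" using assms by (intro mult_right_mono power_mono) auto
  also have "\<dots> = 60 ^ 3 * (\<tau> / 60) ^ 3" by (simp add: power_divide power2_eq_square power3_eq_cube)
  also have "(\<tau> / 60) ^ 3 \<le> exp (\<tau> / 60) ^ 3"
  proof (rule power_mono)
    show "\<tau> / 60 \<le> exp (\<tau> / 60)" using exp_ge_add_one_self[of "\<tau> / 60"] by linarith
  qed (use assms in simp)
  also have "exp (\<tau> / 60) ^ 3 = exp (\<tau> / 20)" by (simp flip: exp_of_nat_mult)
  finally have "\<tau> \<le> exp (\<tau> / 20)" by simp
  then show ?thesis using assms by (metis exp_le_cancel_iff exp_ln less_le_trans zero_less_numeral)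
qed

text \<open>
  \<open>N \<approx> 2 m e\<^sup>\<tau> / \<tau>\<close> leaves room for all degrees, and \<open>D \<approx> 3/2 N x\<close> with \<open>x = sqrt (L / \<tau>)\<close>
  nearly balances the cost \<open>N (N + W) L / D\<close> of Siegel's lemma against the cost \<open>D ln N\<close> of
  the unused equations.
\<close>

lemma parameter_choice:
  fixes m :: nat and L \<tau> c :: real
  assumes m: "2 \<le> m" and L: "2 / 3 \<le> L" and \<tau>: "192 * (real m)\<^sup>2 * L \<le> \<tau>"
    and c: "c \<le> exp (8 / 5 * L)"
  obtains N D K :: nat and A :: real where "2 \<le> N" "1 \<le> D" "K = D + m * (m + 1)" "K \<le> N"
    "A = real N * (real N + real (N div 2)) * (8 / 5 * L) / real D + real K * ln (real N)
      + (real N + 2 * real K + 1 + real (N div 2)) * (8 / 5 * L) + c + ln (2 * real m)"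
    "real m * exp \<tau> + (real (m + 1) * (A + ln (real N)) + real D * ln (real N)) \<le> real N * ln (real N)"
    "real (m + 1) * (A + ln (real N)) + real D * ln (real N) < 12 * (real m)\<^sup>2 * sqrt (L / \<tau>) * exp \<tau>"
proof -
  define x where "x = sqrt (L / \<tau>)"
  define N where "N = nat \<lceil>2 * real m * exp \<tau> / \<tau>\<rceil>"
  define D where "D = nat \<lceil>3 / 2 * real N * x\<rceil>"
  define K where "K = D + m * (m + 1)"
  define W where "W = N div 2"
  define \<kappa> where "\<kappa> = ln (real N)"
  \<comment> \<open>\<open>S\<close> is the logarithm of the size of the Siegel solution,
    \<open>Z\<close> the total loss in the final exponent, and \<open>V\<close> the common unit in
    which the main costs are measured.\<close>
  define S where "S = real N * (real N + real W) * (8 / 5 * L) / real D"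
  define A where "A = S + real K * \<kappa> + (real N + 2 * real K + 1 + real W) * (8 / 5 * L) + c + ln (2 * real m)"
  define Z where "Z = real (m + 1) * (A + \<kappa>) + real D * \<kappa>"
  define V where "V = real N * x * \<tau>"
  let ?m = "real m"
  have m2: "2 \<le> ?m" using m by simp
  have mm4: "4 \<le> ?m\<^sup>2" and m_le: "2 * ?m \<le> ?m\<^sup>2"
    using m2 mult_mono[of 2 ?m 2 ?m] mult_right_mono[of 2 ?m ?m] by (simp_all add: power2_eq_square)
  have "?m\<^sup>2 * (2 / 3) \<le> ?m\<^sup>2 * L" using L by (intro mult_left_mono) auto
  then have mm: "128 * ?m\<^sup>2 \<le> \<tau>" using \<tau> by simp
  then have \<tau>512: "512 \<le> \<tau>" using mm4 by linarith
  have e_half: "16 * \<tau> ^ 4 \<le> exp (\<tau> / 2)" by (rule power4_le_exp_half[OF \<tau>512])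
  have pow: "\<tau> \<le> \<tau>\<^sup>2" "\<tau>\<^sup>2 \<le> \<tau> ^ 3" "\<tau> ^ 3 \<le> \<tau> ^ 4" "1 \<le> \<tau> ^ 4"
    using \<tau>512 power_increasing[of 1 2 \<tau>] power_increasing[of 2 3 \<tau>] power_increasing[of 3 4 \<tau>]
      one_le_power[of \<tau> 4] by simp_all
  have e_sq: "exp (\<tau> / 2) * exp (\<tau> / 2) = exp \<tau>" by (simp flip: exp_add)
  have e_le: "exp (\<tau> / 2) \<le> exp \<tau>" using \<tau>512 by simp
  have x0: "0 < x" using L \<tau>512 by (simp add: x_def)
  have x2: "x\<^sup>2 = L / \<tau>" using L \<tau>512 by (simp add: x_def)
  then have Lx: "L = x * x * \<tau>" using \<tau>512 by (simp add: power2_eq_square)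
  \<comment> \<open>The hypothesis on \<tau> gives (m x)^2 <= 1/192, and 5/69 is a rational bound
    for the root. It makes 12 m x at most 20/23, so that 1 + 20/23 <= 2 * 19/20 leaves enough room
    at the end.\<close>
  have mx: "?m * x \<le> 5 / 69"
  proof (rule power2_le_imp_le)
    have "(?m * x)\<^sup>2 = ?m\<^sup>2 * L / \<tau>" by (simp add: power_mult_distrib x2)
    also have "\<dots> \<le> 1 / 192" using \<tau> \<tau>512 by (simp add: divide_simps)
    also have "\<dots> \<le> (5 / 69)\<^sup>2" by (simp add: power2_eq_square)
    finally show "(?m * x)\<^sup>2 \<le> (5 / 69)\<^sup>2" .
  qed simp
  have "2 * x \<le> ?m * x" using m2 x0 by (intro mult_right_mono) auto
  with mx have x_le: "x \<le> 5 / 138" by linarith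
  have y_pos: "0 < 2 * ?m * exp \<tau> / \<tau>" using m2 \<tau>512 by simp
  have N_ge: "2 * ?m * exp \<tau> / \<tau> \<le> real N" unfolding N_def by linarith
  have N_le: "real N \<le> 2 * ?m * exp \<tau> / \<tau> + 1" unfolding N_def using y_pos by linarith
  have N\<tau>: "2 * ?m * exp \<tau> \<le> real N * \<tau>" "real N * \<tau> \<le> 2 * ?m * exp \<tau> + \<tau>"
    using N_ge N_le \<tau>512 by (simp_all add: field_simps)
  have "exp \<tau> / \<tau> \<le> 2 * ?m * exp \<tau> / \<tau>" using m2 \<tau>512 by (intro divide_right_mono) auto
  with N_ge have N_ge': "exp \<tau> / \<tau> \<le> real N" by linarith
  have \<tau>4: "16 * \<tau> ^ 4 \<le> exp \<tau>" using e_half e_le by linarith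
  have "16 * \<tau> ^ 3 \<le> exp \<tau> / \<tau>" using \<tau>4 \<tau>512 by (simp add: field_simps power4_eq_xxxx power3_eq_cube)
  then have N_big: "16 * \<tau> \<le> real N" using N_ge' pow by linarith
  have N2: "2 \<le> N" using N_big \<tau>512 by linarith
  \<comment> \<open>From N >= e^\<tau> / \<tau>, ln N falls short of \<tau> by at most ln \<tau> <=
    \<tau>/20.\<close>
  have \<kappa>_ge: "19 / 20 * \<tau> \<le> \<kappa>"
  proof -
    have "\<tau> - ln \<tau> = ln (exp \<tau> / \<tau>)" using \<tau>512 by (simp add: ln_div)
    also have "\<dots> \<le> \<kappa>" unfolding \<kappa>_def using N_ge' \<tau>512 by (intro ln_mono) auto
    finally show ?thesis using ln_le_div_20[OF \<tau>512] by linarith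
  qed
  have \<kappa>_le: "\<kappa> \<le> \<tau>"
  proof -
    have "2 * ?m / \<tau> \<le> 1 / 2" using mm m_le \<tau>512 by (simp add: field_simps)
    from mult_right_mono[OF this, of "exp \<tau>"] have "2 * ?m * exp \<tau> / \<tau> \<le> exp \<tau> / 2" by simp
    then have "real N \<le> exp \<tau>" using N_le \<tau>4 pow by linarith
    then have "\<kappa> \<le> ln (exp \<tau>)" unfolding \<kappa>_def using N2 by (intro ln_mono) auto
    then show ?thesis by simp
  qed
  have D_ge: "3 / 2 * real N * x \<le> real D" unfolding D_def by linarith
  have Nx: "0 < real N * x" using N2 x0 by simp
  have D_le: "real D \<le> 3 / 2 * real N * x + 1" unfolding D_def using Nx by linarith
  have D1: "1 \<le> D"
  proof (rule ccontr)
    assume "\<not> 1 \<le> D"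
    then show False using D_ge Nx by (simp add: mult.commute)
  qed
  have W_le: "real W \<le> real N / 2" unfolding W_def by linarith
  have K_eq: "real K = real D + (?m\<^sup>2 + ?m)" by (simp add: K_def power2_eq_square algebra_simps)
  have Nx_le: "real N * x \<le> real N * (5 / 138)" using x_le by (intro mult_left_mono) auto
  have "K \<le> N"
  proof -
    have "real K \<le> real N" using K_eq D_le Nx_le mm m_le N_big \<tau>512 by linarith
    then show ?thesis by simp
  qed
  have V0: "0 < V" using Nx \<tau>512 by (simp add: V_def)
  have S_le: "S \<le> 8 / 5 * V"
  proof -
    have "S \<le> real N * (3 / 2 * real N) * (8 / 5 * L) / (3 / 2 * real N * x)"
      unfolding S_def
      by (intro frac_le mult_right_mono mult_left_mono D_ge) (use W_le L Nx x0 N2 in auto)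
    also have "\<dots> = 8 / 5 * V" using N2 x0 by (simp add: V_def Lx)
    finally show ?thesis .
  qed
  have D\<kappa>: "real D * \<kappa> \<le> 3 / 2 * V + \<tau>"
  proof -
    have "real D * \<kappa> \<le> (3 / 2 * real N * x + 1) * \<tau>"
      using D_le \<kappa>_le \<kappa>_ge \<tau>512 Nx by (intro mult_mono) auto
    then show ?thesis by (simp add: V_def algebra_simps)
  qed
  have K\<kappa>: "real K * \<kappa> \<le> 3 / 2 * V + \<tau> + (?m\<^sup>2 + ?m) * \<tau>"
    using D\<kappa> mult_left_mono[OF \<kappa>_le, of "?m\<^sup>2 + ?m"] by (simp add: K_eq distrib_right)
  have "(real N + 2 * real K + 1 + real W) * (8 / 5 * L)
      \<le> (3 / 2 * real N + 3 * (real N * (5 / 138)) + (2 * ?m\<^sup>2 + 2 * ?m + 3)) * (8 / 5 * L)"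
    using W_le D_le Nx_le L by (intro mult_right_mono) (auto simp: K_eq)
  also have "\<dots> = (3 / 2 + 15 / 138) * 8 / 5 * x * V + (2 * ?m\<^sup>2 + 2 * ?m + 3) * (8 / 5 * L)"
    by (simp add: V_def Lx algebra_simps)
  also have "(3 / 2 + 15 / 138) * 8 / 5 * x * V \<le> 1 / 10 * V"
    using x_le V0 by (intro mult_right_mono) auto
  finally have G_le: "(real N + 2 * real K + 1 + real W) * (8 / 5 * L)
      \<le> 1 / 10 * V + (2 * ?m\<^sup>2 + 2 * ?m + 3) * (8 / 5 * L)" by simp
  have quad: "(2 * ?m\<^sup>2 + 2 * ?m + 3) * (8 / 5 * L) \<le> \<tau>"
  proof -
    have "(2 * ?m\<^sup>2 + 2 * ?m + 3) * (8 / 5 * L) \<le> (4 * ?m\<^sup>2) * (8 / 5 * L)"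
      using m_le mm4 L by (intro mult_right_mono) auto
    also have "\<dots> = 32 / 5 * (?m\<^sup>2 * L)" by simp
    also have "\<dots> \<le> 192 * (?m\<^sup>2 * L)" using L by (intro mult_right_mono) auto
    also have "\<dots> \<le> \<tau>" using \<tau> by (simp add: mult.assoc)
    finally show ?thesis .
  qed
  have c_le: "c \<le> exp (\<tau> / 2)"
  proof -
    have "4 * L \<le> ?m\<^sup>2 * L" using mm4 L by (intro mult_right_mono) auto
    then have "8 / 5 * L \<le> \<tau> / 2" using \<tau> L by linarith
    then show ?thesis using c by (meson exp_le_cancel_iff order_trans)
  qed
  have ln2m: "ln (2 * ?m) \<le> \<tau>"
    using ln_le_minus_one[of "2 * ?m"] m2 m_le mm by linarith
  \<comment> \<open>The coefficient 16/5 of V below is 8/5 from Siegel's lemma, 3/2 from K ln N and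
    1/10 from the powers of g and 1 + \<rho>; \<open>r\<close> collects terms of lower
    order.\<close>
  define r where "r = (?m\<^sup>2 + ?m + 5) * \<tau> + exp (\<tau> / 2)"
  have "(?m\<^sup>2 + ?m + 5) * \<tau> = (?m\<^sup>2 + ?m) * \<tau> + 5 * \<tau>"
    by (simp add: distrib_right)
  then have A_le: "A + \<kappa> \<le> 16 / 5 * V + r"
    unfolding A_def r_def using S_le K\<kappa> order_trans[OF G_le add_left_mono[OF quad]] c_le ln2m \<kappa>_le \<tau>512
    by linarith
  have r0: "0 \<le> r" using \<tau>512 by (simp add: r_def add_nonneg_nonneg)
  have V_le: "V \<le> 2 * (?m * x) * exp \<tau> + \<tau>"
  proof -
    have "V \<le> (2 * ?m * exp \<tau> + \<tau>) * x"
      unfolding V_def using mult_right_mono[OF N\<tau>(2), of x] x0 by (simp add: mult_ac)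
    also have "\<dots> \<le> 2 * (?m * x) * exp \<tau> + \<tau>"
      using x_le \<tau>512 by (simp add: algebra_simps)
    finally show ?thesis .
  qed
  have "Z \<le> (?m + 1) * (16 / 5 * V + r) + (3 / 2 * V + \<tau>)"
    unfolding Z_def of_nat_add of_nat_1 by (intro add_mono mult_left_mono A_le D\<kappa>) simp
  also have "\<dots> = (16 / 5 * ?m + 47 / 10) * V + ((?m + 1) * r + \<tau>)"
    by (simp add: field_simps)
  \<comment> \<open>Here 47/10 <= 47/20 m is used. With V about 2 m x e^\<tau> the main term gets
    the constant 111/10, and the remaining 9/10 of the final 12 pays for the lower-order
    terms.\<close>
  also have "\<dots> \<le> (111 / 20 * ?m) * V + ((?m + 1) * r + \<tau>)"
    using m2 V0 by (intro add_right_mono mult_right_mono) auto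
  also have "\<dots> \<le> (111 / 20 * ?m) * (2 * (?m * x) * exp \<tau> + \<tau>) + ((?m + 1) * r + \<tau>)"
    using V_le m2 by (intro add_right_mono mult_left_mono) auto
  also have "\<dots> = 111 / 10 * ?m\<^sup>2 * x * exp \<tau> + (111 / 20 * ?m * \<tau> + (?m + 1) * r + \<tau>)"
    by (simp add: algebra_simps power2_eq_square)
  also have "111 / 20 * ?m * \<tau> + (?m + 1) * r + \<tau> < 9 / 10 * ?m\<^sup>2 * x * exp \<tau>"
  proof -
    have m1: "?m + 1 \<le> \<tau>" "?m\<^sup>2 + ?m + 5 \<le> \<tau>" "111 / 20 * ?m \<le> \<tau>"
      using mm m_le mm4 m2 by linarith+
    have r_le: "r \<le> \<tau>\<^sup>2 + exp (\<tau> / 2)"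
      unfolding r_def using mult_right_mono[OF m1(2), of \<tau>] \<tau>512 by (simp add: power2_eq_square)
    have "111 / 20 * ?m * \<tau> + (?m + 1) * r + \<tau> \<le> \<tau> * \<tau> + \<tau> * (\<tau>\<^sup>2 + exp (\<tau> / 2)) + \<tau>"
      using m1 r_le r0 \<tau>512 by (intro add_mono mult_mono mult_right_mono order_refl) auto
    from mult_left_mono[OF this, of \<tau>] \<tau>512
    have "\<tau> * (111 / 20 * ?m * \<tau> + (?m + 1) * r + \<tau>) \<le> \<tau> ^ 3 + \<tau> ^ 4 + \<tau>\<^sup>2 * exp (\<tau> / 2) + \<tau>\<^sup>2"
      by (simp add: algebra_simps power2_eq_square power3_eq_cube power4_eq_xxxx)
    also have "\<dots> \<le> 3 * \<tau> ^ 4 + \<tau> ^ 4 * exp (\<tau> / 2)"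
    proof -
      have "\<tau>\<^sup>2 * exp (\<tau> / 2) \<le> \<tau> ^ 4 * exp (\<tau> / 2)" using pow by (intro mult_right_mono) auto
      then show ?thesis using pow by linarith
    qed
    also have "\<dots> < 12 / 5 * exp \<tau>"
    proof -
      have "16 * \<tau> ^ 4 * exp (\<tau> / 2) \<le> exp (\<tau> / 2) * exp (\<tau> / 2)"
        by (intro mult_right_mono e_half) simp
      then show ?thesis using \<tau>4 e_sq exp_gt_zero[of \<tau>] by linarith
    qed
    also have "12 / 5 \<le> \<tau> * (9 / 10 * ?m\<^sup>2 * x)"
    proof -
      \<comment> \<open>Since x <= 1, x is at least x^2 = L/\<tau>; so x is not too small to absorb
        terms of size e^(\<tau>/2) times a power of \<tau>.\<close>
      have "L / \<tau> \<le> x"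
      proof -
        have "x * x \<le> x * 1" using x_le x0 by (intro mult_left_mono) auto
        then show ?thesis using x2 by (simp add: power2_eq_square)
      qed
      then have "2 / 3 \<le> \<tau> * x" using L \<tau>512 by (simp add: field_simps)
      with mm4 have "4 * (2 / 3) \<le> ?m\<^sup>2 * (\<tau> * x)" by (intro mult_mono) auto
      then show ?thesis by (simp add: mult_ac)
    qed
    finally have "\<tau> * (111 / 20 * ?m * \<tau> + (?m + 1) * r + \<tau>) < \<tau> * (9 / 10 * ?m\<^sup>2 * x * exp \<tau>)"
      by (simp add: mult.assoc)
    then show ?thesis using \<tau>512 by simp
  qed
  finally have Z_less: "Z < 12 * ?m\<^sup>2 * x * exp \<tau>" by (simp add: mult_ac)
  have "?m * exp \<tau> + Z \<le> real N * \<kappa>"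
  proof -
    have "12 * ?m\<^sup>2 * x * exp \<tau> = 12 * (?m * x) * (?m * exp \<tau>)" by (simp add: power2_eq_square)
    also have "\<dots> \<le> 12 * (5 / 69) * (?m * exp \<tau>)"
      by (intro mult_right_mono mult_left_mono mx) auto
    finally have "Z \<le> 20 / 23 * (?m * exp \<tau>)" using Z_less by linarith
    moreover have "19 / 20 * (real N * \<tau>) \<le> real N * \<kappa>"
      using mult_left_mono[OF \<kappa>_ge, of "real N"] by simp
    moreover have "0 \<le> ?m * exp \<tau>" by simp
    ultimately show ?thesis using N\<tau>(1) by linarith
  qed
  then show ?thesis
    using that[of N D K A] N2 D1 \<open>K \<le> N\<close> Z_less
    unfolding K_def[symmetric] x_def[symmetric]
    by (simp add: A_def S_def W_def \<kappa>_def Z_def K_def)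
qed

section \<open>Lower bound for linear forms\<close>

text \<open>The error at index 0 vanishes because exp(\<theta> 0) = 1, which lets the sum of errors
  start at 1.\<close>

lemma linear_form_eq:
  fixes y \<beta> :: "nat \<Rightarrow> int" and \<theta> :: "nat \<Rightarrow> real"
  assumes "\<theta> 0 = 0"
  shows "real_of_int (\<Sum>i\<le>m. \<beta> i * y i) = real_of_int (y 0) * (\<Sum>i\<le>m. real_of_int (\<beta> i) * exp (\<theta> i))
    - (\<Sum>i = 1..m. real_of_int (\<beta> i) * (real_of_int (y 0) * exp (\<theta> i) - real_of_int (y i)))"
proof -
  have "(\<Sum>i\<le>m. real_of_int (\<beta> i) * (real_of_int (y 0) * exp (\<theta> i) - real_of_int (y i)))
      = (\<Sum>i = 1..m. real_of_int (\<beta> i) * (real_of_int (y 0) * exp (\<theta> i) - real_of_int (y i)))"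
    by (simp add: assms sum.atLeast_Suc_atMost flip: atLeast0AtMost)
  then show ?thesis
    by (simp add: algebra_simps sum_subtractf sum_distrib_left)
qed

text \<open>The nonzero integer combination of the \<open>y i\<close> has absolute value at least 1
  and the errors take up at most 1/2, so |y 0| times the linear form is at least 1/2. Index 0
  carries no error, hence the sum of logarithms starts at 1.\<close>

lemma exp_linear_form_lower_bound:
  fixes \<theta> :: "nat \<Rightarrow> real" and g :: int and \<beta> :: "nat \<Rightarrow> int"
  assumes m: "2 \<le> m" and g: "1 \<le> g" and g\<theta>: "\<And>i. i \<le> m \<Longrightarrow> real_of_int g * \<theta> i \<in> \<int>"
    and inj: "inj_on \<theta> {..m}" and \<theta>0: "\<theta> 0 = 0" and \<rho>: "\<And>i. i \<le> m \<Longrightarrow> \<bar>\<theta> i\<bar> \<le> \<rho>"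
    and L: "2 / 3 \<le> L" "real_of_int g * (1 + \<rho>) \<le> exp (8 / 5 * L)"
    and \<tau>: "192 * (real m)\<^sup>2 * L \<le> \<tau>"
    and \<beta>: "\<And>i. i \<le> m \<Longrightarrow> ln (real_of_int (h \<beta> i)) \<le> exp \<tau>" and j: "j \<le> m" "\<beta> j \<noteq> 0"
  shows "exp (\<rho> - (\<Sum>i = 1..m. ln (real_of_int (h \<beta> i))) - 12 * (real m)\<^sup>2 * sqrt (L / \<tau>) * exp \<tau>)
    < \<bar>\<Sum>i\<le>m. real_of_int (\<beta> i) * exp (\<theta> i)\<bar>"
proof -
  let ?c = "1 + \<rho>" and ?G = "real_of_int g * (1 + \<rho>)"
  have \<rho>0: "0 \<le> \<rho>" using \<rho>[of 0] by simp
  have "1 * ?c \<le> ?G" using g \<rho>0 by (intro mult_right_mono) auto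
  then have cG: "?c \<le> ?G" by simp
  then have c: "?c \<le> exp (8 / 5 * L)" using L(2) by linarith
  obtain N D K A where N2: "2 \<le> N" and D1: "1 \<le> D" and K: "K = D + m * (m + 1)" "K \<le> N"
    and A_eq: "A = real N * (real N + real (N div 2)) * (8 / 5 * L) / real D + real K * ln (real N)
      + (real N + 2 * real K + 1 + real (N div 2)) * (8 / 5 * L) + ?c + ln (2 * real m)"
    and room: "real m * exp \<tau> + (real (m + 1) * (A + ln (real N)) + real D * ln (real N)) \<le> real N * ln (real N)"
    and Z: "real (m + 1) * (A + ln (real N)) + real D * ln (real N) < 12 * (real m)\<^sup>2 * sqrt (L / \<tau>) * exp \<tau>"
    by (rule parameter_choice[OF m L(1) \<tau> c])
  define W where "W = N div 2"
  define \<kappa> where "\<kappa> = ln (real N)"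
  define S where "S = real N * (real N + real W) * (8 / 5 * L) / real D"
  define T where "T = (real N + 2 * real K + 1 + real W) * (8 / 5 * L)"
  \<comment> \<open>Apart from N^(w i + 1), \<open>A\<close> contains the logarithm of every factor
    in the error bound, together with ln (2 m).\<close>
  note A_eq = A_eq[folded W_def \<kappa>_def, folded S_def T_def]
  note room = room[folded \<kappa>_def] and Z = Z[folded \<kappa>_def]
  have \<kappa>0: "0 < \<kappa>" using N2 by (simp add: \<kappa>_def)
  have "0 \<le> S" "0 \<le> T" using L(1) by (simp_all add: S_def T_def)
  moreover have "0 \<le> ln (2 * real m)" using m by simp
  ultimately have A0: "0 \<le> A" using \<kappa>0 \<rho>0 by (simp add: A_eq)
  let ?h = "\<lambda>i. real_of_int (h \<beta> i)"
  have h1: "1 \<le> ?h i" for i by (simp add: h_def)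
  have lnh: "0 \<le> ln (?h i)" for i using h1[of i] by simp
  \<comment> \<open>\<open>w i\<close> is the least exponent with N^(w i) >= h_i e^A, just enough to
    bring |\<beta> i| times the i-th error below 1/(2 m).\<close>
  define w where "w = (\<lambda>i. nat \<lceil>(ln (?h i) + A) / \<kappa>\<rceil>)"
  have w_ge: "ln (?h i) + A \<le> real (w i) * \<kappa>" for i
  proof -
    have "(ln (?h i) + A) / \<kappa> \<le> real (w i)" unfolding w_def by linarith
    then show ?thesis using \<kappa>0 by (simp add: field_simps)
  qed
  have w_le: "real (w i) * \<kappa> \<le> ln (?h i) + (A + \<kappa>)" for i
  proof -
    have "0 \<le> (ln (?h i) + A) / \<kappa>" using lnh[of i] A0 \<kappa>0 by simp
    then have "real (w i) \<le> (ln (?h i) + A) / \<kappa> + 1" unfolding w_def by linarith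
    then show ?thesis using \<kappa>0 by (simp add: field_simps)
  qed
  define U where "U = (\<Sum>i = 1..m. w i) + D"
  have U\<kappa>: "real U * \<kappa> \<le> (\<Sum>i = 1..m. ln (?h i)) + real m * (A + \<kappa>) + real D * \<kappa>"
  proof -
    have "(\<Sum>i = 1..m. real (w i) * \<kappa>) \<le> (\<Sum>i = 1..m. ln (?h i) + (A + \<kappa>))"
      by (intro sum_mono w_le)
    then show ?thesis by (simp add: U_def distrib_right sum_distrib_right sum.distrib)
  qed
  have "(\<Sum>i = 1..m. ln (?h i)) \<le> (\<Sum>i = 1..m. exp \<tau>)" by (intro sum_mono \<beta>) auto
  then have "(\<Sum>i = 1..m. ln (?h i)) \<le> real m * exp \<tau>" by simp
  moreover have "real (m + 1) * (A + \<kappa>) = real m * (A + \<kappa>) + (A + \<kappa>)"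
    by (simp add: distrib_right)
  ultimately have "real U * \<kappa> \<le> real N * \<kappa>"
    using U\<kappa> room A0 \<kappa>0 by linarith
  then have UN: "U \<le> N + 1" using \<kappa>0 by simp
  \<comment> \<open>The factor m >= 2 in \<open>room\<close> forces each single \<open>w i\<close>
    below N/2.\<close>
  have wW: "w i \<le> W" if "i \<le> m" for i
  proof -
    have "2 * (real (w i) * \<kappa>) \<le> real m * (real (w i) * \<kappa>)"
      using m \<kappa>0 by (intro mult_right_mono) auto
    also have "\<dots> \<le> real m * (exp \<tau> + (A + \<kappa>))"
      using w_le[of i] \<beta>[OF that] by (intro mult_left_mono) auto
    also have "\<dots> \<le> real N * \<kappa>"
    proof -
      have "0 \<le> real D * \<kappa>" using \<kappa>0 by simp
      moreover have "real (m + 1) * (A + \<kappa>) = real m * (A + \<kappa>) + (A + \<kappa>)"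
        "real m * (exp \<tau> + (A + \<kappa>)) = real m * exp \<tau> + real m * (A + \<kappa>)"
        by (simp_all add: distrib_right distrib_left)
      ultimately show ?thesis using room A0 \<kappa>0 by linarith
    qed
    finally have "2 * real (w i) \<le> real N" using \<kappa>0 by simp
    then show ?thesis unfolding W_def by linarith
  qed
  have G1: "1 \<le> ?G" using cG \<rho>0 by linarith
  \<comment> \<open>D S equals N (N + W) 8L/5, which bounds the logarithm of the left side of
    Siegel's condition because U - D <= N. Hence H + 1 > e^S suffices.\<close>
  define H where "H = nat \<lfloor>exp S\<rfloor>"
  have "0 \<le> exp S" by simp
  then have H: "real H \<le> exp S" "exp S < real H + 1" unfolding H_def by linarith+
  have "?G ^ ((N + W) * (U - D)) \<le> ?G ^ ((N + W) * N)"
    using G1 UN D1 by (intro power_increasing mult_le_mono2) auto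
  also have "\<dots> \<le> exp (8 / 5 * L) ^ ((N + W) * N)"
    using L(2) G1 by (intro power_mono) auto
  also have "\<dots> = exp (real ((N + W) * N) * (8 / 5 * L))"
    by (rule exp_of_nat_mult[symmetric])
  also have "real ((N + W) * N) * (8 / 5 * L) = real D * S"
    using D1 by (simp add: S_def)
  also have "exp \<dots> = exp S ^ D" by (rule exp_of_nat_mult)
  also have "\<dots> < (real H + 1) ^ D"
    using H(2) D1 by (intro power_strict_mono) auto
  finally have HD: "?G ^ ((N + W) * (U - D)) < (real H + 1) ^ D" .
  obtain y :: "nat \<Rightarrow> int" where y: "(\<Sum>i\<le>m. \<beta> i * y i) \<noteq> 0"
    "\<bar>real_of_int (y 0)\<bar> \<le> real_of_int g ^ (N + K) * real H * real N ^ (U + K + 1)"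
    "\<And>i. 0 < i \<Longrightarrow> i \<le> m \<Longrightarrow> \<bar>real_of_int (y 0) * exp (\<theta> i) - real_of_int (y i)\<bar>
      \<le> real_of_int g ^ (N + K) * real H * (1 + \<rho>) ^ (2 * K + N + 1 + W) * exp (1 + \<rho>)
          * real N ^ K / real N ^ (w i + 1)"
    using exp_approximations[where \<theta> = \<theta> and \<beta> = \<beta> and w = w,
        OF g g\<theta> inj \<theta>0 \<rho> wW U_def UN D1 K N2 HD j] by blast
  have N_power: "real N ^ n = exp (real n * \<kappa>)" for n
    using N2 by (simp add: \<kappa>_def exp_of_nat_mult)
  have gc: "real_of_int g ^ (N + K) * (1 + \<rho>) ^ (2 * K + N + 1 + W) \<le> exp T"
  proof -
    have "real_of_int g ^ (N + K) * (1 + \<rho>) ^ (2 * K + N + 1 + W)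
        \<le> real_of_int g ^ (2 * K + N + 1 + W) * (1 + \<rho>) ^ (2 * K + N + 1 + W)"
      using g \<rho>0 by (intro mult_right_mono power_increasing) auto
    also have "\<dots> = ?G ^ (2 * K + N + 1 + W)" by (simp only: power_mult_distrib)
    also have "\<dots> \<le> exp (8 / 5 * L) ^ (2 * K + N + 1 + W)"
      using L(2) G1 by (intro power_mono) auto
    also have "\<dots> = exp (real (2 * K + N + 1 + W) * (8 / 5 * L))"
      by (rule exp_of_nat_mult[symmetric])
    also have "real (2 * K + N + 1 + W) * (8 / 5 * L) = T" by (simp add: T_def)
    finally show ?thesis .
  qed
  have small: "\<bar>real_of_int (\<beta> i) * (real_of_int (y 0) * exp (\<theta> i) - real_of_int (y i))\<bar> \<le> 1 / (2 * real m)"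
    if i: "i \<in> {1..m}" for i
  proof -
    have "\<bar>real_of_int (y 0) * exp (\<theta> i) - real_of_int (y i)\<bar>
        \<le> (real_of_int g ^ (N + K) * (1 + \<rho>) ^ (2 * K + N + 1 + W)) * real H * exp ?c * real N ^ K / real N ^ (w i + 1)"
      using y(3)[of i] i by (simp add: mult_ac)
    also have "\<dots> \<le> exp T * exp S * exp ?c * real N ^ K / real N ^ (w i + 1)"
      using gc H(1) by (intro divide_right_mono mult_right_mono mult_mono) auto
    also have "\<dots> = exp (T + S + ?c + real K * \<kappa> - real (w i + 1) * \<kappa>)"
      by (simp only: N_power exp_add exp_diff)
    also have "\<dots> \<le> exp (- ln (?h i) - ln (2 * real m))"
      using w_ge[of i] \<kappa>0 by (simp add: A_eq distrib_right)
    also have "\<dots> = 1 / (?h i * (2 * real m))"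
      using h1[of i] m by (simp add: exp_diff exp_minus field_simps)
    finally have "\<bar>real_of_int (y 0) * exp (\<theta> i) - real_of_int (y i)\<bar> \<le> 1 / (?h i * (2 * real m))" .
    moreover have "\<bar>real_of_int (\<beta> i)\<bar> \<le> ?h i" by (simp add: h_def)
    ultimately have "\<bar>real_of_int (\<beta> i)\<bar> * \<bar>real_of_int (y 0) * exp (\<theta> i) - real_of_int (y i)\<bar>
        \<le> ?h i * (1 / (?h i * (2 * real m)))"
      using h1[of i] by (intro mult_mono) auto
    then show ?thesis using h1[of i] by (simp add: abs_mult)
  qed
  let ?\<Lambda> = "\<Sum>i\<le>m. real_of_int (\<beta> i) * exp (\<theta> i)"
  let ?E = "\<Sum>i = 1..m. real_of_int (\<beta> i) * (real_of_int (y 0) * exp (\<theta> i) - real_of_int (y i))"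
  have "\<bar>?E\<bar> \<le> (\<Sum>i = 1..m. 1 / (2 * real m))"
    by (intro order_trans[OF sum_abs] sum_mono small)
  also have "\<dots> = 1 / 2" using m by simp
  finally have E: "\<bar>?E\<bar> \<le> 1 / 2" .
  have "1 \<le> \<bar>real_of_int (\<Sum>i\<le>m. \<beta> i * y i)\<bar>"
    using y(1) by linarith
  then have half: "1 / 2 \<le> \<bar>real_of_int (y 0)\<bar> * \<bar>?\<Lambda>\<bar>"
    using E abs_triangle_ineq4[of "real_of_int (y 0) * ?\<Lambda>" ?E]
    unfolding linear_form_eq[where \<theta> = \<theta> and y = y, OF \<theta>0] abs_mult by linarith
  have "real_of_int g ^ (N + K) * 1 \<le> real_of_int g ^ (N + K) * (1 + \<rho>) ^ (2 * K + N + 1 + W)"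
    using g \<rho>0 by (intro mult_left_mono one_le_power) auto
  then have gT: "real_of_int g ^ (N + K) \<le> exp T" using gc by linarith
  have "\<bar>real_of_int (y 0)\<bar> \<le> exp T * exp S * real N ^ (U + K + 1)"
    using gT H(1) by (intro order_trans[OF y(2)] mult_right_mono mult_mono) auto
  also have "\<dots> = exp (T + S + real (U + K + 1) * \<kappa>)"
    by (simp only: N_power exp_add)
  finally have "\<bar>real_of_int (y 0)\<bar> * \<bar>?\<Lambda>\<bar> \<le> exp (T + S + real (U + K + 1) * \<kappa>) * \<bar>?\<Lambda>\<bar>"
    by (rule mult_right_mono) simp
  with half have "1 / 2 \<le> exp (T + S + real (U + K + 1) * \<kappa>) * \<bar>?\<Lambda>\<bar>" by linarith
  then have "exp (- (T + S + real (U + K + 1) * \<kappa>)) * (1 / 2)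
      \<le> exp (- (T + S + real (U + K + 1) * \<kappa>)) * (exp (T + S + real (U + K + 1) * \<kappa>) * \<bar>?\<Lambda>\<bar>)"
    by (rule mult_left_mono) simp
  also have "\<dots> = \<bar>?\<Lambda>\<bar>" by (simp flip: mult.assoc exp_add)
  finally have "exp (- (T + S + real (U + K + 1) * \<kappa>) - ln 2) \<le> \<bar>?\<Lambda>\<bar>"
    by (simp add: exp_diff)
  \<comment> \<open>Since S + T + K \<kappa> = A - (1 + \<rho>) - ln (2 m), the summand 1 + \<rho>
    of A yields the gain \<rho>, and ln (2 m) pays for ln 2.\<close>
  moreover have "\<rho> - (\<Sum>i = 1..m. ln (?h i)) - 12 * (real m)\<^sup>2 * sqrt (L / \<tau>) * exp \<tau>
      < - (T + S + real (U + K + 1) * \<kappa>) - ln 2"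
  proof -
    have "ln 2 \<le> ln (2 * real m)" using m by simp
    then show ?thesis using U\<kappa> Z by (simp add: A_eq algebra_simps)
  qed
  ultimately show ?thesis by (meson exp_less_cancel_iff less_le_trans)
qed

section \<open>Denominators and sizes of the rational exponents\<close>

lemma g1_pos: "1 \<le> g1 m \<gamma>"
proof -
  have "snd (quotient_of (\<gamma> j)) \<noteq> 0" for j
    using quotient_of_denom_pos'[of "\<gamma> j"] by simp
  then have "0 \<notin> (\<lambda>j. snd (quotient_of (\<gamma> j))) ` {0..m}" by fastforce
  then have "g1 m \<gamma> \<noteq> 0" unfolding g1_def by (subst Lcm_0_iff) auto
  moreover have "0 \<le> g1 m \<gamma>" by (simp add: g1_def)
  ultimately show ?thesis by linarith
qed

lemma g1_mult_in_Ints: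
  assumes "j \<le> m" shows "real_of_int (g1 m \<gamma>) * real_of_rat (\<gamma> j) \<in> \<int>"
proof -
  obtain a b where ab: "quotient_of (\<gamma> j) = (a, b)" by (cases "quotient_of (\<gamma> j)")
  have "b dvd g1 m \<gamma>"
    unfolding g1_def using assms ab by (intro dvd_Lcm) (auto intro!: image_eqI[of _ _ j])
  then obtain z where z: "g1 m \<gamma> = b * z" by (elim dvdE)
  have "b \<noteq> 0" using quotient_of_denom_pos[OF ab] by simp
  then have "real_of_int (g1 m \<gamma>) * real_of_rat (\<gamma> j) = of_int (z * a)"
    by (simp add: z quotient_of_div[OF ab] of_rat_divide)
  then show ?thesis by (metis Ints_of_int)
qed

lemma abs_le_g3:
  assumes "j \<le> m" shows "\<bar>real_of_rat (\<gamma> j)\<bar> \<le> real_of_rat (g3 m \<gamma>)"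
proof -
  have "\<bar>\<gamma> j\<bar> \<le> g3 m \<gamma>" unfolding g3_def using assms by (intro Max_ge) auto
  then have "real_of_rat \<bar>\<gamma> j\<bar> \<le> real_of_rat (g3 m \<gamma>)" by (simp add: of_rat_less_eq)
  then show ?thesis by simp
qed

text \<open>By distinctness one of \<gamma> 0 and \<gamma> 1 is nonzero, and its product with the
  common denominator is a nonzero integer.\<close>

lemma g1_g3_ge_1:
  assumes "2 \<le> m" "inj_on \<gamma> {0..m}"
  shows "1 \<le> real_of_int (g1 m \<gamma>) * real_of_rat (g3 m \<gamma>)"
proof -
  have "\<gamma> 0 \<noteq> \<gamma> 1" using assms inj_onD[OF assms(2), of 0 1] by auto
  then have "\<gamma> 0 \<noteq> 0 \<or> \<gamma> 1 \<noteq> 0" by simp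
  then obtain j where j: "j \<le> m" "\<gamma> j \<noteq> 0"
    using assms(1) by (metis one_le_numeral order_trans zero_le)
  have "1 \<le> \<bar>real_of_int (g1 m \<gamma>) * real_of_rat (\<gamma> j)\<bar>"
    using g1_mult_in_Ints[OF j(1)] g1_pos[of m \<gamma>] j(2) by (intro Ints_nonzero_abs_ge1) auto
  also have "\<dots> \<le> real_of_int (g1 m \<gamma>) * real_of_rat (g3 m \<gamma>)"
    using abs_le_g3[OF j(1), of \<gamma>] g1_pos[of m \<gamma>] by (simp add: abs_mult mult_left_mono)
  finally show ?thesis .
qed

text \<open>This is the source of the exponent 8/5. The auxiliary bounds 3/4 G^2 and 9/8 G^3 are
  attained at G = 2, and (9/8)^2 * 3/4 = 243/256 is below 1.\<close>

lemma two_mult_diff_one_power5_le: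
  assumes G: "2 \<le> (G :: real)" shows "(2 * G - 1) ^ 5 \<le> G ^ 8"
proof -
  have "0 \<le> (G - 2) * (3 * G - 2)" using G by simp
  then have 1: "2 * G - 1 \<le> 3 / 4 * G ^ 2" by (simp add: algebra_simps power2_eq_square)
  have "2 * G \<le> G * G" using G by (intro mult_right_mono) auto
  then have "0 \<le> (G - 2) * (9 * (G * G) - 14 * G + 4)"
    using G by (intro mult_nonneg_nonneg) linarith+
  then have 2: "(2 * G - 1) ^ 2 \<le> 9 / 8 * G ^ 3"
    by (simp add: algebra_simps power2_eq_square power3_eq_cube)
  have "(2 * G - 1) ^ 5 = (2 * G - 1) ^ 2 * (2 * G - 1) ^ 2 * (2 * G - 1)"
    by (simp add: eval_nat_numeral)
  also have "\<dots> \<le> (9 / 8 * G ^ 3) * (9 / 8 * G ^ 3) * (3 / 4 * G ^ 2)"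
    using G by (intro mult_mono 1 2) auto
  also have "\<dots> = 243 / 256 * G ^ 8" by (simp add: eval_nat_numeral)
  also have "\<dots> \<le> G ^ 8" using G by simp
  finally show ?thesis .
qed

text \<open>The quadratic bound 1 + t + t^2 for exp t at t = 1/12 is 157/144, whose eighth power is
  still below 2.\<close>

lemma two_thirds_le_ln_2: "2 / 3 \<le> ln (2 :: real)"
proof -
  have "exp (2 / 3) = exp (1 / 12 :: real) ^ 8" by (simp flip: exp_of_nat_mult)
  also have "\<dots> \<le> (157 / 144) ^ 8"
    using exp_bound[of "1 / 12"] by (intro power_mono) (auto simp: power2_eq_square)
  also have "\<dots> \<le> 2" by (simp add: power_divide)
  finally show ?thesis by (subst ln_ge_iff) simp_all
qed

text \<open>Differences of exponents can reach 2 \<open>g3\<close>, while the logarithm involves 1 +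
  \<open>g3\<close> only. With G = g1 (1 + g3) and g1 >= 1, the quantity g1 (1 + 2 g3) is at most 2
  G - 1.\<close>

lemma log_g_bounds:
  assumes "2 \<le> m" "inj_on \<gamma> {0..m}"
  shows "2 / 3 \<le> log_g m \<gamma>"
    and "real_of_int (g1 m \<gamma>) * (1 + 2 * real_of_rat (g3 m \<gamma>)) \<le> exp (8 / 5 * log_g m \<gamma>)"
proof -
  define G where "G = real_of_int (g1 m \<gamma>) * (1 + real_of_rat (g3 m \<gamma>))"
  have g1: "1 \<le> real_of_int (g1 m \<gamma>)" using g1_pos[of m \<gamma>] by simp
  have G: "2 \<le> G" using g1_g3_ge_1[OF assms] g1 by (simp add: G_def distrib_left)
  have L: "log_g m \<gamma> = ln G" by (simp add: log_g_def G_def)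
  have "ln 2 \<le> ln G" using G by simp
  then show "2 / 3 \<le> log_g m \<gamma>" using two_thirds_le_ln_2 L by linarith
  have "exp (8 / 5 * log_g m \<gamma>) ^ 5 = exp (real 5 * (8 / 5 * log_g m \<gamma>))"
    by (rule exp_of_nat_mult[symmetric])
  also have "real 5 * (8 / 5 * log_g m \<gamma>) = real 8 * ln G" by (simp add: L)
  also have "exp \<dots> = exp (ln G) ^ 8" by (rule exp_of_nat_mult)
  also have "\<dots> = G ^ 8" using G by simp
  finally have "(2 * G - 1) ^ 5 \<le> exp (8 / 5 * log_g m \<gamma>) ^ 5"
    using two_mult_diff_one_power5_le[OF G] by simp
  then have "2 * G - 1 \<le> exp (8 / 5 * log_g m \<gamma>)"
    by (rule power_le_imp_le_base[of _ 4, simplified]) simp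
  then show "real_of_int (g1 m \<gamma>) * (1 + 2 * real_of_rat (g3 m \<gamma>)) \<le> exp (8 / 5 * log_g m \<gamma>)"
    using g1 by (simp add: G_def algebra_simps)
qed

text \<open>Swapping 0 with the index of a largest entry and factoring out its exponential gives
  \<open>\<theta> 0 = 0\<close>. That entry then contributes no logarithm to the bound, which is
  where the factor M in the numerator comes from.\<close>

lemma rational_exponents_lower_bound:
  fixes m :: nat and \<gamma> :: "nat \<Rightarrow> rat" and \<beta> :: "nat \<Rightarrow> int"
  assumes m: "2 \<le> m" and inj: "inj_on \<gamma> {0..m}" and nz: "\<exists>i\<in>{0..m}. \<beta> i \<noteq> 0"
  defines "M \<equiv> real_of_int (max_abs m \<beta>)" and "L \<equiv> log_g m \<gamma>"
  assumes M: "96 * (real m)\<^sup>2 * L * exp (192 * (real m)\<^sup>2 * L) \<le> ln M"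
  shows "M powr (1 - 12 * (real m)\<^sup>2 * sqrt L / sqrt (ln (ln M))) / (\<Prod>i=0..m. real_of_int (h \<beta> i))
    < \<bar>\<Sum>i=0..m. real_of_int (\<beta> i) * exp (real_of_rat (\<gamma> i))\<bar>"
proof -
  have "max_abs m \<beta> \<in> (\<lambda>i. \<bar>\<beta> i\<bar>) ` {0..m}" unfolding max_abs_def by (intro Max_in) auto
  then obtain i\<^sub>0 where i0: "i\<^sub>0 \<le> m" "max_abs m \<beta> = \<bar>\<beta> i\<^sub>0\<bar>" by auto
  have le_M: "\<bar>\<beta> i\<bar> \<le> max_abs m \<beta>" if "i \<le> m" for i
    unfolding max_abs_def using that by (intro Max_ge) auto
  have M1: "1 \<le> M" unfolding M_def using nz le_M by fastforce
  have hM: "h \<beta> i\<^sub>0 = max_abs m \<beta>" using M1 i0 by (simp add: h_def M_def)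
  have h_le: "real_of_int (h \<beta> i) \<le> M" if "i \<le> m" for i
    using le_M[OF that] M1 by (simp add: h_def M_def)
  note L = log_g_bounds[OF m inj, folded L_def]
  have "4 \<le> (real m)\<^sup>2" using m mult_mono[of 2 "real m" 2 "real m"] by (simp add: power2_eq_square)
  then have "4 * (2 / 3) \<le> (real m)\<^sup>2 * L" using L(1) by (intro mult_mono) auto
  \<comment> \<open>The prefactor 96 m^2 L is at least 1 and is dropped, which leaves \<tau> = ln
    (ln M) >= 192 m^2 L.\<close>
  then have "1 * exp (192 * (real m)\<^sup>2 * L) \<le> 96 * (real m)\<^sup>2 * L * exp (192 * (real m)\<^sup>2 * L)"
    by (intro mult_right_mono) auto
  with M have lnM: "exp (192 * (real m)\<^sup>2 * L) \<le> ln M" by linarith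
  define \<tau> where "\<tau> = ln (ln M)"
  have lnM0: "0 < ln M" using lnM exp_gt_zero less_le_trans by blast
  then have exp_\<tau>: "exp \<tau> = ln M" by (simp add: \<tau>_def)
  then have \<tau>: "192 * (real m)\<^sup>2 * L \<le> \<tau>" using lnM by (metis exp_le_cancel_iff)
  define \<pi> where "\<pi> = Transposition.transpose 0 i\<^sub>0"
  have \<pi>_bij: "bij_betw \<pi> {..m} {..m}"
    unfolding \<pi>_def using i0(1) by simp
  have \<pi>_le: "\<pi> i \<le> m" if "i \<le> m" for i
    using bij_betwE[OF \<pi>_bij] that by simp
  have \<pi>0: "\<pi> 0 = i\<^sub>0" by (simp add: \<pi>_def)
  let ?\<gamma> = "\<lambda>i. real_of_rat (\<gamma> i)"
  define \<theta> where "\<theta> = (\<lambda>i. ?\<gamma> (\<pi> i) - ?\<gamma> i\<^sub>0)"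
  let ?\<rho> = "2 * real_of_rat (g3 m \<gamma>)"
  have "inj_on \<theta> {..m}"
  proof (rule inj_onI)
    fix a b assume ab: "a \<in> {..m}" "b \<in> {..m}" "\<theta> a = \<theta> b"
    then have "\<gamma> (\<pi> a) = \<gamma> (\<pi> b)" by (simp add: \<theta>_def)
    then have "\<pi> a = \<pi> b" using inj ab \<pi>_le by (simp add: inj_on_def)
    then show "a = b" using bij_betw_imp_inj_on[OF \<pi>_bij] ab by (simp add: inj_on_def)
  qed
  moreover have "real_of_int (g1 m \<gamma>) * \<theta> i \<in> \<int>" if "i \<le> m" for i
    unfolding \<theta>_def right_diff_distrib
    by (intro Ints_diff g1_mult_in_Ints \<pi>_le that i0(1))
  moreover have "\<bar>\<theta> i\<bar> \<le> ?\<rho>" if "i \<le> m" for i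
    using abs_le_g3[OF \<pi>_le[OF that], of \<gamma>] abs_le_g3[OF i0(1), of \<gamma>]
    unfolding \<theta>_def by linarith
  moreover have "ln (real_of_int (h (\<beta> \<circ> \<pi>) i)) \<le> exp \<tau>" if "i \<le> m" for i
    using h_le[OF \<pi>_le[OF that]] unfolding exp_\<tau> by (intro ln_mono) (auto simp: h_def)
  moreover have "(\<beta> \<circ> \<pi>) 0 \<noteq> 0" using M1 i0(2) by (auto simp: \<pi>0 M_def)
  ultimately have bound: "exp (?\<rho> - (\<Sum>i = 1..m. ln (real_of_int (h (\<beta> \<circ> \<pi>) i)))
        - 12 * (real m)\<^sup>2 * sqrt (L / \<tau>) * exp \<tau>)
      < \<bar>\<Sum>i\<le>m. real_of_int ((\<beta> \<circ> \<pi>) i) * exp (\<theta> i)\<bar>"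
    using exp_linear_form_lower_bound[of m "g1 m \<gamma>" \<theta> ?\<rho> L \<tau> "\<beta> \<circ> \<pi>" 0] m g1_pos[of m \<gamma>] L \<tau>
    by (simp add: \<theta>_def \<pi>0)
  let ?\<Lambda> = "\<Sum>i=0..m. real_of_int (\<beta> i) * exp (?\<gamma> i)"
  have "?\<Lambda> = (\<Sum>i\<le>m. real_of_int (\<beta> (\<pi> i)) * exp (?\<gamma> (\<pi> i)))"
    unfolding atLeast0AtMost by (rule sum.reindex_bij_betw[OF \<pi>_bij, symmetric])
  also have "\<dots> = exp (?\<gamma> i\<^sub>0) * (\<Sum>i\<le>m. real_of_int ((\<beta> \<circ> \<pi>) i) * exp (\<theta> i))"
    by (simp add: sum_distrib_left \<theta>_def exp_diff)
  finally have \<Lambda>: "\<bar>?\<Lambda>\<bar> = exp (?\<gamma> i\<^sub>0) * \<bar>\<Sum>i\<le>m. real_of_int ((\<beta> \<circ> \<pi>) i) * exp (\<theta> i)\<bar>"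
    by (simp add: abs_mult)
  have h_comp: "h (\<beta> \<circ> \<pi>) i = h \<beta> (\<pi> i)" for i by (simp add: h_def)
  have "ln (\<Prod>i=0..m. real_of_int (h \<beta> i)) = (\<Sum>i\<le>m. ln (real_of_int (h \<beta> i)))"
    unfolding atLeast0AtMost by (rule ln_prod) (auto simp: h_def)
  also have "\<dots> = (\<Sum>i\<le>m. ln (real_of_int (h \<beta> (\<pi> i))))"
    by (rule sum.reindex_bij_betw[OF \<pi>_bij, symmetric])
  also have "\<dots> = ln M + (\<Sum>i = 1..m. ln (real_of_int (h (\<beta> \<circ> \<pi>) i)))"
    by (simp add: sum.atLeast_Suc_atMost \<pi>0 hM M_def h_comp flip: atLeast0AtMost)
  finally have ln_prod: "ln (\<Prod>i=0..m. real_of_int (h \<beta> i))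
      = ln M + (\<Sum>i = 1..m. ln (real_of_int (h (\<beta> \<circ> \<pi>) i)))" .
  have prod_pos: "0 < (\<Prod>i=0..m. real_of_int (h \<beta> i))"
    by (rule prod_pos) (auto simp: h_def)
  let ?\<delta> = "12 * (real m)\<^sup>2 * sqrt L / sqrt (ln (ln M))"
  have "M powr (1 - ?\<delta>) / (\<Prod>i=0..m. real_of_int (h \<beta> i))
      = exp ((1 - ?\<delta>) * ln M - ln (\<Prod>i=0..m. real_of_int (h \<beta> i)))"
    using M1 prod_pos by (simp add: powr_def exp_diff)
  \<comment> \<open>ln M cancels against the factor of the product at \<open>i\<^sub>0\<close>, and
    the remaining ln M is e^\<tau>.\<close>
  also have "(1 - ?\<delta>) * ln M - ln (\<Prod>i=0..m. real_of_int (h \<beta> i))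
      = - (\<Sum>i = 1..m. ln (real_of_int (h (\<beta> \<circ> \<pi>) i))) - 12 * (real m)\<^sup>2 * sqrt (L / \<tau>) * exp \<tau>"
    unfolding ln_prod exp_\<tau> \<tau>_def[symmetric] by (simp add: real_sqrt_divide left_diff_distrib)
  also have "exp \<dots> \<le> exp (?\<gamma> i\<^sub>0) * exp (?\<rho> - (\<Sum>i = 1..m. ln (real_of_int (h (\<beta> \<circ> \<pi>) i)))
        - 12 * (real m)\<^sup>2 * sqrt (L / \<tau>) * exp \<tau>)"
  proof -
    \<comment> \<open>The gain e^\<rho> with \<rho> = 2 g3 outweighs the factor exp(\<gamma>) at
      \<open>i\<^sub>0\<close>, which may be as small as exp(-g3).\<close>
    have "0 \<le> ?\<gamma> i\<^sub>0 + ?\<rho>" using abs_le_g3[OF i0(1), of \<gamma>] by linarith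
    then show ?thesis by (simp flip: exp_add)
  qed
  also have "\<dots> < \<bar>?\<Lambda>\<bar>"
    unfolding \<Lambda> by (intro mult_strict_left_mono bound) simp
  finally show ?thesis .
qed

theorem corollary2p4:
  fixes m :: nat and \<gamma> :: "nat \<Rightarrow> rat"
  assumes "m \<ge> 2"
    and "inj_on \<gamma> {0..m}"
  shows "\<exists>B :: real. B \<le> c_const m * (real m)\<^sup>2 * sqrt (log_g m \<gamma>) \<and>
    (\<exists>\<delta> :: int \<Rightarrow> real. \<forall>\<beta> :: nat \<Rightarrow> int.
      (\<exists>i\<in>{0..m}. \<beta> i \<noteq> 0) \<longrightarrow>
      ln (real_of_int (max_abs m \<beta>))
        \<ge> 96 * (real m)\<^sup>2 * log_g m \<gamma> * exp (192 * (real m)\<^sup>2 * log_g m \<gamma>) \<longrightarrow>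
      \<delta> (max_abs m \<beta>) \<le> B / sqrt (ln (ln (real_of_int (max_abs m \<beta>)))) \<and>
      \<bar>\<Sum>i=0..m. real_of_int (\<beta> i) * exp (real_of_rat (\<gamma> i))\<bar>
        > real_of_int (max_abs m \<beta>) powr (1 - \<delta> (max_abs m \<beta>))
            / (\<Prod>i=0..m. real_of_int (h \<beta> i)))"
\<comment> \<open>\<delta> is taken equal to its upper bound, with the constant 12 <= c_m; it
  depends on \<beta> through M only.\<close>
proof (intro exI[of _ "12 * (real m)\<^sup>2 * sqrt (log_g m \<gamma>)"] conjI
    exI[of _ "\<lambda>M. 12 * (real m)\<^sup>2 * sqrt (log_g m \<gamma>) / sqrt (ln (ln (real_of_int M)))"] allI impI)
  show "12 * (real m)\<^sup>2 * sqrt (log_g m \<gamma>) \<le> c_const m * (real m)\<^sup>2 * sqrt (log_g m \<gamma>)"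
    using log_g_bounds(1)[OF assms] by (intro mult_right_mono) (auto simp: c_const_def)
qed (use rational_exponents_lower_bound[OF assms] in auto)

end
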